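(* Let $\Omega$ and $\Omega'$ be domains of the Poincaré half-plane $\mathbb{H}$, $\widetilde\Omega=\Psi(S^1\times\Omega)$, $\widetilde\Omega'=\Psi(S^1\times\Omega')$. Let $g:\Omega\to\Omega'$ and $f:\widetilde\Omega\to\widetilde\Omega'$ be quasiconformal maps with $\Pi\circ f=g\circ\Pi$. Let $\Gamma$ be a curve family in $\Omega$ with extremal density $\rho_0$. Suppose: 1) $M(\widetilde\Gamma)=\int_{\widetilde\Omega}(\Pi^\ast\rho_0)^4\,dL^3$, where $\widetilde\Gamma$ is the lifted family of $\Gamma$; 2) $M(g(\Gamma))=\int_\Omega\rho_0^2\,K(\cdot,g)\,dL^2$; 3) $M(\widetilde{g(\Gamma)})=\int_{\widetilde\Omega'}(\Pi^\ast(g_\ast\rho_0))^4\,dL^3$, where $\widetilde{g(\Gamma)}$ is the lifted family of $g(\Gamma)$. Then $$M(f(\widetilde\Gamma))=\int_{\widetilde\Omega}(\Pi^\ast\rho_0)^4\,K(\cdot,f)^2\,dL^3.$$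
   Context: The Heisenberg group $\mathbf{H}$ is $\mathbb{C}\times\mathbb{R}$ with law $(z,t)\ast(z',t')=(z+z',t+t'+2\Im(z\overline{z'}))$, norm $\|(z,t)\|=(|z|^4+t^2)^{1/4}$ and distance $d(p,q)=\|p^{-1}\ast q\|$. Set $Z=\partial_z+i\overline z\,\partial_t$, $\overline Z=\partial_{\overline z}-iz\,\partial_t$ and $\omega=dt-i\overline z\,dz+iz\,d\overline z$. A homeomorphism $f$ between domains of $\mathbf{H}$ is quasiconformal if $H(p,f)=\limsup_{r\to0}\frac{\max_{d(p,q)=r}d(f(p),f(q))}{\min_{d(p,q)=r}d(f(p),f(q))}$ is uniformly bounded. Standing assumption: all quasiconformal maps (in $\mathbf{H}$ and in $\mathbb{C}$) are $C^2$ and orientation preserving, and all curves are $C^1$. Such a map $f=(f_1,f_2)$ of $\mathbf{H}$ ($f_1$ complex valued, $f_2$ real valued) is contact ($f^\ast\omega=\lambda\omega$ with $\lambda$ a nowhere vanishing real function), and orientation preserving means that $\overline Zf_1=\mu Zf_1$ and $\overline Z(f_2+i|f_1|^2)=\mu Z(f_2+i|f_1|^2)$ for some $\mu\in L^\infty$ with $\|\mu\|_{L^\infty}<1$. The distortion function is $K(p,f)=\frac{|Zf_1(p)|+|\overline Zf_1(p)|}{|Zf_1(p)|-|\overline Zf_1(p)|}$; for $g$ in the plane, $K(\cdot,g)=\frac{|\partial_wg|+|\partial_{\overline w}g|}{|\partial_wg|-|\partial_{\overline w}g|}$. The projection $\Pi:\mathbf{H}\setminus(\{0\}\times\mathbb{R})\to\mathbb{H}$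 is $\Pi(z,t)=t+i|z|^2$, and $\Psi(e^{i\theta},w)=(\sqrt{\Im(w)}\,e^{i\theta},\Re(w))$ is a diffeomorphism $S^1\times\mathbb{H}\to\mathbf{H}\setminus(\{0\}\times\mathbb{R})$. A $C^1$ curve $\gamma=(\gamma_1,\gamma_2)$ in $\mathbf{H}$ is horizontal if $\dot\gamma_2=-2\Im(\overline{\gamma_1}\dot\gamma_1)$. The lifted family $\widetilde\Gamma$ of a curve family $\Gamma$ in $\Omega\subset\mathbb{H}$ is the family of all horizontal curves $\widetilde\gamma$ with $\Pi(\widetilde\gamma)\in\Gamma$. Moduli. In a domain $\Omega\subset\mathbb{C}$: $adm(\Gamma)$ is the set of measurable $\rho:\Omega\to[0,\infty]$ with $\int\rho(\gamma(s))|\dot\gamma(s)|ds\ge1$ for all $\gamma\in\Gamma$, and $M(\Gamma)=\inf_{\rho\in adm(\Gamma)}\int_\Omega\rho^2dL^2$. In a domain $\Omega\subset\mathbf{H}$, for a family $\Gamma$ of horizontal curves: $adm(\Gamma)$ is the set of measurable $\rho:\Omega\to[0,\infty]$ with $\int\rho(\gamma(s))|\dot\gamma_1(s)|ds\ge1$ for all $\gamma\in\Gamma$, and $M(\Gamma)=\inf_{\rho\in adm(\Gamma)}\int_\Omega\rho^4dL^3$. Here $dL^2,dL^3$ are Lebesgue measures. An element of $adm(\Gamma)$ attaining the infimum is an extremal density of $\Gamma$ (it is essentially unique when it exists). Push-forward in $\mathbb{C}$: $g_\ast\rho=\frac{\rho}{|\partial_wg|-|\partial_{\overline w}g|}\circ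 g^{-1}$. Pull-back by $\Pi$: $(\Pi^\ast\rho)(z,t)=2|z|\,\rho(t+i|z|^2)$. *)

theory Defs
  imports "HOL-Analysis.Analysis" "HOL-Probability.Essential_Supremum"
begin

section \<open>The Heisenberg group and the half-plane\<close>

type_synonym heis = "complex \<times> real"

definition heis_mult :: "heis \<Rightarrow> heis \<Rightarrow> heis" where
  "heis_mult p q = (fst p + fst q, snd p + snd q + 2 * Im (fst p * cnj (fst q)))"

definition heis_inv :: "heis \<Rightarrow> heis" where
  "heis_inv p = (- fst p, - snd p)"

definition heis_norm :: "heis \<Rightarrow> real" where
  "heis_norm p = root 4 (cmod (fst p) ^ 4 + (snd p)\<^sup>2)"

text \<open>The instance \<open>dist\<close> on the product type is the Euclidean distance. It induces the same
  topology as \<open>heis_dist\<close>, so the topological notions of the library are used unchanged.\<close>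

definition heis_dist :: "heis \<Rightarrow> heis \<Rightarrow> real" where
  "heis_dist p q = heis_norm (heis_mult (heis_inv p) q)"

definition upper_half_plane :: "complex set" where
  "upper_half_plane = {w. Im w > 0}"

text \<open>A total function; off the axis \<open>{0} \<times> \<real>\<close> its values are in the upper half-plane,
  on the axis they are real.\<close>

definition Pi_proj :: "heis \<Rightarrow> complex" where
  "Pi_proj p = of_real (snd p) + \<i> * of_real ((cmod (fst p))\<^sup>2)"

definition Psi :: "complex \<times> complex \<Rightarrow> heis" where
  "Psi \<xi> = (of_real (sqrt (Im (snd \<xi>))) * fst \<xi>, Re (snd \<xi>))"

definition lifted_domain :: "complex set \<Rightarrow> heis set" where
  "lifted_domain \<Omega> = Psi ` (sphere 0 1 \<times> \<Omega>)"

section \<open>Differential operators\<close>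

definition d_w :: "(complex \<Rightarrow> complex) \<Rightarrow> complex \<Rightarrow> complex" where
  "d_w g w = (let D = frechet_derivative g (at w) in (D 1 - \<i> * D \<i>) / 2)"

definition d_wbar :: "(complex \<Rightarrow> complex) \<Rightarrow> complex \<Rightarrow> complex" where
  "d_wbar g w = (let D = frechet_derivative g (at w) in (D 1 + \<i> * D \<i>) / 2)"

definition Z_op :: "(heis \<Rightarrow> complex) \<Rightarrow> heis \<Rightarrow> complex" where
  "Z_op u p = (let D = frechet_derivative u (at p) in
     (D (1, 0) - \<i> * D (\<i>, 0)) / 2 + \<i> * cnj (fst p) * D (0, 1))"

definition Zbar_op :: "(heis \<Rightarrow> complex) \<Rightarrow> heis \<Rightarrow> complex" where
  "Zbar_op u p = (let D = frechet_derivative u (at p) in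
     (D (1, 0) + \<i> * D (\<i>, 0)) / 2 - \<i> * fst p * D (0, 1))"

definition C2_on :: "'a::real_normed_vector set \<Rightarrow> ('a \<Rightarrow> 'b::real_normed_vector) \<Rightarrow> bool" where
  "C2_on S f \<longleftrightarrow> (\<exists>(f' :: 'a \<Rightarrow> 'a \<Rightarrow>\<^sub>L 'b) (f'' :: 'a \<Rightarrow> 'a \<Rightarrow>\<^sub>L 'a \<Rightarrow>\<^sub>L 'b).
     (\<forall>x\<in>S. (f has_derivative blinfun_apply (f' x)) (at x)) \<and>
     (\<forall>x\<in>S. (f' has_derivative blinfun_apply (f'' x)) (at x)) \<and>
     continuous_on S f'')"

section \<open>Quasiconformal maps\<close>

text \<open>For small \<open>r\<close> the sphere is compact and contained in the open set \<open>\<Omega>\<close>, so that supremum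
  and infimum are the maximum and the minimum. For an injective \<open>f\<close> the latter is positive.\<close>

definition lin_dilatation ::
    "('a \<Rightarrow> 'a \<Rightarrow> real) \<Rightarrow> 'a set \<Rightarrow> ('a \<Rightarrow> 'a) \<Rightarrow> 'a \<Rightarrow> ereal" where
  "lin_dilatation d \<Omega> f p = Limsup (at_right 0) (\<lambda>r. ereal
     ((SUP q\<in>{q\<in>\<Omega>. d p q = r}. d (f p) (f q)) / (INF q\<in>{q\<in>\<Omega>. d p q = r}. d (f p) (f q))))"

definition bounded_dilatation ::
    "('a \<Rightarrow> 'a \<Rightarrow> real) \<Rightarrow> 'a set \<Rightarrow> ('a \<Rightarrow> 'a) \<Rightarrow> bool" where
  "bounded_dilatation d \<Omega> f \<longleftrightarrow> (\<exists>C::real. \<forall>p\<in>\<Omega>. lin_dilatation d \<Omega> f p \<le> ereal C)"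

text \<open>\<open>esssup\<close> is infinite for non-measurable functions, but measurability of the modulus of
  \<open>\<mu>\<close> does not give that of \<open>\<mu>\<close>, which is therefore required separately.\<close>

definition beltrami_coefficient :: "'a::euclidean_space set \<Rightarrow> ('a \<Rightarrow> complex) \<Rightarrow> bool" where
  "beltrami_coefficient \<Omega> \<mu> \<longleftrightarrow> \<mu> \<in> borel_measurable (lebesgue_on \<Omega>) \<and>
     esssup (lebesgue_on \<Omega>) (\<lambda>x. ereal (cmod (\<mu> x))) < 1"

definition orientation_preserving_plane :: "complex set \<Rightarrow> (complex \<Rightarrow> complex) \<Rightarrow> bool" where
  "orientation_preserving_plane \<Omega> g \<longleftrightarrow> (\<exists>\<mu>. beltrami_coefficient \<Omega> \<mu> \<and>
     (AE w in lebesgue_on \<Omega>. d_wbar g w = \<mu> w * d_w g w))"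

definition orientation_preserving_heis :: "heis set \<Rightarrow> (heis \<Rightarrow> heis) \<Rightarrow> bool" where
  "orientation_preserving_heis \<Omega> f \<longleftrightarrow>
    (let f\<^sub>1 = (\<lambda>p. fst (f p));
         h = (\<lambda>p. of_real (snd (f p)) + \<i> * of_real ((cmod (fst (f p)))\<^sup>2))
     in \<exists>\<mu>. beltrami_coefficient \<Omega> \<mu> \<and>
        (AE p in lebesgue_on \<Omega>. Zbar_op f\<^sub>1 p = \<mu> p * Z_op f\<^sub>1 p \<and>
                                 Zbar_op h p = \<mu> p * Z_op h p))"

definition quasiconformal_plane ::
    "complex set \<Rightarrow> complex set \<Rightarrow> (complex \<Rightarrow> complex) \<Rightarrow> bool" where
  "quasiconformal_plane \<Omega> \<Omega>' g \<longleftrightarrow> (\<exists>h. homeomorphism \<Omega> \<Omega>' g h) \<and>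
     bounded_dilatation dist \<Omega> g \<and> C2_on \<Omega> g \<and> orientation_preserving_plane \<Omega> g"

text \<open>The contact equation is not part of the definition: a \<open>C\<^sup>2\<close> map which does not send
  horizontal vectors to horizontal vectors at \<open>p\<close> has infinite linear dilatation at \<open>p\<close>.\<close>

definition quasiconformal_heis :: "heis set \<Rightarrow> heis set \<Rightarrow> (heis \<Rightarrow> heis) \<Rightarrow> bool" where
  "quasiconformal_heis \<Omega> \<Omega>' f \<longleftrightarrow> (\<exists>h. homeomorphism \<Omega> \<Omega>' f h) \<and>
     bounded_dilatation heis_dist \<Omega> f \<and> C2_on \<Omega> f \<and> orientation_preserving_heis \<Omega> f"

definition K_plane :: "(complex \<Rightarrow> complex) \<Rightarrow> complex \<Rightarrow> real" where
  "K_plane g w = (cmod (d_w g w) + cmod (d_wbar g w)) / (cmod (d_w g w) - cmod (d_wbar g w))"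

definition K_heis :: "(heis \<Rightarrow> heis) \<Rightarrow> heis \<Rightarrow> real" where
  "K_heis f p = (let f\<^sub>1 = (\<lambda>q. fst (f q)) in
     (cmod (Z_op f\<^sub>1 p) + cmod (Zbar_op f\<^sub>1 p)) / (cmod (Z_op f\<^sub>1 p) - cmod (Zbar_op f\<^sub>1 p)))"

section \<open>Curve families\<close>

text \<open>A curve is a pair of a parameter interval of any kind (open, closed, half-open, bounded or
  not, but not a single point) and a function, whose values outside the interval are
  irrelevant. Derivatives are taken within the interval.\<close>

type_synonym 'a curve = "real set \<times> (real \<Rightarrow> 'a)"

fun C1_curve :: "'a::real_normed_vector curve \<Rightarrow> bool" where
  "C1_curve (I, \<gamma>) \<longleftrightarrow> is_interval I \<and> interior I \<noteq> {} \<and>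
     (\<exists>D. continuous_on I D \<and> (\<forall>s\<in>I. (\<gamma> has_vector_derivative D s) (at s within I)))"

definition curve_family_in :: "'a::real_normed_vector set \<Rightarrow> 'a curve set \<Rightarrow> bool" where
  "curve_family_in \<Omega> \<Gamma> \<longleftrightarrow> (\<forall>(I, \<gamma>)\<in>\<Gamma>. C1_curve (I, \<gamma>) \<and> \<gamma> ` I \<subseteq> \<Omega>)"

fun horizontal_curve :: "heis curve \<Rightarrow> bool" where
  "horizontal_curve (I, \<gamma>) \<longleftrightarrow> C1_curve (I, \<gamma>) \<and>
     (\<forall>s\<in>I. vector_derivative (snd \<circ> \<gamma>) (at s within I) =
       - 2 * Im (cnj (fst (\<gamma> s)) * vector_derivative (fst \<circ> \<gamma>) (at s within I)))"

definition image_family :: "('a \<Rightarrow> 'b) \<Rightarrow> 'a curve set \<Rightarrow> 'b curve set" where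
  "image_family f \<Gamma> = {(I, f \<circ> \<gamma>) | I \<gamma>. (I, \<gamma>) \<in> \<Gamma>}"

definition lifted_family :: "complex curve set \<Rightarrow> heis curve set" where
  "lifted_family \<Gamma> = {(I, \<gamma>). horizontal_curve (I, \<gamma>) \<and>
     (\<exists>c. (I, c) \<in> \<Gamma> \<and> (\<forall>s\<in>I. Pi_proj (\<gamma> s) = c s))}"

section \<open>Moduli\<close>

text \<open>Densities are Borel measurable, so that the line integrals are defined. Only their values
  on \<open>\<Omega>\<close> matter.\<close>

definition adm_plane :: "complex set \<Rightarrow> complex curve set \<Rightarrow> (complex \<Rightarrow> ennreal) set" where
  "adm_plane \<Omega> \<Gamma> = {\<rho>. \<rho> \<in> borel_measurable (restrict_space borel \<Omega>) \<and>
     (\<forall>(I, \<gamma>)\<in>\<Gamma>. (\<integral>\<^sup>+s\<in>I. (\<rho> (\<gamma> s) *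
        ennreal (cmod (vector_derivative \<gamma> (at s within I)))) \<partial>lborel) \<ge> 1)}"

definition modulus_plane :: "complex set \<Rightarrow> complex curve set \<Rightarrow> ennreal" where
  "modulus_plane \<Omega> \<Gamma> = (INF \<rho>\<in>adm_plane \<Omega> \<Gamma>. \<integral>\<^sup>+w\<in>\<Omega>. (\<rho> w)^2 \<partial>lborel)"

definition extremal_density_plane ::
    "complex set \<Rightarrow> complex curve set \<Rightarrow> (complex \<Rightarrow> ennreal) \<Rightarrow> bool" where
  "extremal_density_plane \<Omega> \<Gamma> \<rho> \<longleftrightarrow> \<rho> \<in> adm_plane \<Omega> \<Gamma> \<and>
     (\<integral>\<^sup>+w\<in>\<Omega>. (\<rho> w)^2 \<partial>lborel) = modulus_plane \<Omega> \<Gamma>"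

definition adm_heis :: "heis set \<Rightarrow> heis curve set \<Rightarrow> (heis \<Rightarrow> ennreal) set" where
  "adm_heis \<Omega> \<Gamma> = {\<rho>. \<rho> \<in> borel_measurable (restrict_space borel \<Omega>) \<and>
     (\<forall>(I, \<gamma>)\<in>\<Gamma>. (\<integral>\<^sup>+s\<in>I. (\<rho> (\<gamma> s) *
        ennreal (cmod (vector_derivative (fst \<circ> \<gamma>) (at s within I)))) \<partial>lborel) \<ge> 1)}"

definition modulus_heis :: "heis set \<Rightarrow> heis curve set \<Rightarrow> ennreal" where
  "modulus_heis \<Omega> \<Gamma> = (INF \<rho>\<in>adm_heis \<Omega> \<Gamma>. \<integral>\<^sup>+p\<in>\<Omega>. (\<rho> p)^4 \<partial>lborel)"

definition push_forward ::
    "complex set \<Rightarrow> (complex \<Rightarrow> complex) \<Rightarrow> (complex \<Rightarrow> ennreal) \<Rightarrow> complex \<Rightarrow> ennreal" where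
  "push_forward \<Omega> g \<rho> =
     (\<lambda>w. \<rho> w / ennreal (cmod (d_w g w) - cmod (d_wbar g w))) \<circ> the_inv_into \<Omega> g"

definition Pi_pull_back :: "(complex \<Rightarrow> ennreal) \<Rightarrow> heis \<Rightarrow> ennreal" where
  "Pi_pull_back \<rho> p = ennreal (2 * cmod (fst p)) * \<rho> (Pi_proj p)"

end

theory Submission
  imports Defs
begin

text \<open>
  The Beltrami equations for \<open>f\<^sub>1\<close> and \<open>f\<^sub>2 + i |f\<^sub>1|\<^sup>2\<close> have the same coefficient of modulus less than one,
  which forces \<open>f\<close> to be contact. Contact maps send horizontal curves to horizontal curves, and
  horizontal lifts with a given initial point exist and are unique; hence \<open>f\<close> maps the lifts of \<open>\<Gamma>\<close>
  onto the lifts of \<open>g(\<Gamma>)\<close>. No differentiability of the inverse of \<open>f\<close>, which may fail, is needed: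
  a lift of \<open>g \<circ> c\<close> is compared with the image under \<open>f\<close> of a lift of \<open>c\<close>.

  By assumption 3 it remains to transform an integral by \<open>f\<close>. For a contact \<open>C\<^sup>2\<close> map the Jacobian is
  \<open>(|Z f\<^sub>1|\<^sup>2 - |Zbar f\<^sub>1|\<^sup>2)\<^sup>2\<close>, and differentiating \<open>\<Pi> \<circ> f = g \<circ> \<Pi>\<close> gives
  \<open>|f\<^sub>1| |Z f\<^sub>1| = |z| |d_w g|\<close> and \<open>|f\<^sub>1| |Zbar f\<^sub>1| = |z| |d_wbar g|\<close>, from which the integrands agree.
  Where the Jacobian vanishes both integrands are zero, since there \<open>K_heis f p = 0\<close> by division by zero.
\<close>

section \<open>Symmetry of second derivatives\<close>

text \<open>The second difference \<open>\<Delta>\<close> over the parallelogram spanned by t u and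
  t v is symmetric in u and v, while its leading term is both t^2 \<open>f'' v u\<close> and t^2
  \<open>f'' u v\<close>. The symmetry removes the second derivatives from the bracket computation
  in \<open>contact_form_vertical\<close>.\<close>

lemma symmetric_second_derivative:
  fixes f :: "'a::real_normed_vector \<Rightarrow> 'b::real_normed_vector"
    and f' :: "'a \<Rightarrow> 'a \<Rightarrow>\<^sub>L 'b" and f'' :: "'a \<Rightarrow> 'a \<Rightarrow>\<^sub>L 'b"
  assumes "open S" "x \<in> S"
    and f: "\<And>y. y \<in> S \<Longrightarrow> (f has_derivative f' y) (at y)"
    and f': "(f' has_derivative f'') (at x)"
  shows "f'' u v = f'' v u"
proof (rule ccontr)
  assume ne: "f'' u v \<noteq> f'' v u"
  define N where "N = norm u + norm v"
  have lin: "linear f''"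
    using f' has_derivative_linear by blast
  have "N > 0"
    using ne by (cases "u = 0"; cases "v = 0") (auto simp: N_def add_pos_nonneg add_nonneg_pos)
  \<comment> \<open>Each comparison of \<open>\<Delta>\<close> with a leading term costs 2
    \<open>\<epsilon>\<close> (t N)^2. With 6 in the denominator the two together stay at 2/3 of the
    supposed discrepancy, times t^2.\<close>
  define \<epsilon> where "\<epsilon> = norm (f'' u v - f'' v u) / (6 * N * N)"
  have "\<epsilon> > 0"
    using ne \<open>N > 0\<close> by (simp add: \<epsilon>_def)
  obtain \<delta> where "\<delta> > 0" and \<delta>: "\<And>y. norm (y - x) < \<delta> \<Longrightarrow> norm (f' y - f' x - f'' (y - x)) \<le> \<epsilon> * norm (y - x)"
    using f' \<open>\<epsilon> > 0\<close> unfolding has_derivative_at_alt by blast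
  obtain r where "r > 0" and r: "ball x r \<subseteq> S"
    using assms(1,2) openE by blast
  \<comment> \<open>All points used below lie within t N of \<open>x\<close>, hence in
    \<open>S\<close> and where the estimate \<open>\<delta>\<close> applies.\<close>
  define t where "t = min \<delta> r / (2 * N)"
  have "t > 0" and tN: "t * N < \<delta>" "t * N < r"
    using \<open>\<delta> > 0\<close> \<open>r > 0\<close> \<open>N > 0\<close> by (auto simp: t_def min_def)
  define \<Delta> where "\<Delta> = f (x + t *\<^sub>R u + t *\<^sub>R v) - f (x + t *\<^sub>R u) - f (x + t *\<^sub>R v) + f x"
  \<comment> \<open>The mean value inequality in one direction for the difference quotient in the other.\<close>
  have key: "norm (\<Delta> - (t * t) *\<^sub>R f'' b a) \<le> 2 * \<epsilon> * (t * t * N * N)"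
    if ab: "norm a + norm b = N" "norm a \<le> N"
      and \<Delta>: "\<Delta> = f (x + t *\<^sub>R a + t *\<^sub>R b) - f (x + t *\<^sub>R a) - f (x + t *\<^sub>R b) + f x" for a b
  proof -
    \<comment> \<open>\<open>G\<close> follows the increment in direction \<open>b\<close> along
      \<open>a\<close>, corrected by its expected growth, so that \<open>G t - G 0\<close> is
      \<open>\<Delta>\<close> minus the leading term.\<close>
    define G where "G s = f (x + s *\<^sub>R a + t *\<^sub>R b) - f (x + s *\<^sub>R a) - (s * t) *\<^sub>R f'' b a" for s
    define G' where "G' s = (\<lambda>h. h *\<^sub>R (f' (x + s *\<^sub>R a + t *\<^sub>R b) a - f' (x + s *\<^sub>R a) a - t *\<^sub>R f'' b a))" for s
    have near: "norm (s *\<^sub>R a + t *\<^sub>R b) \<le> t * N" "norm (s *\<^sub>R a) \<le> t * N" if "s \<in> {0..t}" for s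
    proof -
      have "norm (s *\<^sub>R a + t *\<^sub>R b) \<le> s * norm a + t * norm b"
        using that \<open>t > 0\<close> norm_triangle_ineq[of "s *\<^sub>R a" "t *\<^sub>R b"] by auto
      also have "\<dots> \<le> t * norm a + t * norm b"
        using that by (intro add_mono mult_right_mono) auto
      finally show "norm (s *\<^sub>R a + t *\<^sub>R b) \<le> t * N"
        by (simp add: ab(1)[symmetric] distrib_left)
      show "norm (s *\<^sub>R a) \<le> t * N"
        using that \<open>t > 0\<close> ab by (auto intro!: mult_mono)
    qed
    have inS: "x + s *\<^sub>R a + t *\<^sub>R b \<in> S" "x + s *\<^sub>R a \<in> S" if "s \<in> {0..t}" for s
      using near[OF that] tN r by (auto simp: subset_iff dist_norm add.assoc norm_minus_commute)
    have "norm (G t - G 0) \<le> 2 * \<epsilon> * (t * N * N) * norm (t - 0)"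
    proof (rule differentiable_bound[where f' = G' and S = "{0..t}"])
      show "(G has_derivative G' s) (at s within {0..t})" if "s \<in> {0..t}" for s
      proof -
        have 1: "((\<lambda>s. f (x + s *\<^sub>R a + t *\<^sub>R b)) has_derivative (\<lambda>h. f' (x + s *\<^sub>R a + t *\<^sub>R b) (h *\<^sub>R a))) (at s within {0..t})"
          using f[OF inS(1)[OF that]]
          by (intro has_derivative_compose[where g = f and f = "\<lambda>s. x + s *\<^sub>R a + t *\<^sub>R b"])
             (auto intro!: derivative_eq_intros)
        have 2: "((\<lambda>s. f (x + s *\<^sub>R a)) has_derivative (\<lambda>h. f' (x + s *\<^sub>R a) (h *\<^sub>R a))) (at s within {0..t})"
          using f[OF inS(2)[OF that]]
          by (intro has_derivative_compose[where g = f and f = "\<lambda>s. x + s *\<^sub>R a"])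
             (auto intro!: derivative_eq_intros)
        show ?thesis
          unfolding G_def G'_def
          by (rule derivative_eq_intros 1 2 refl | simp)+
             (auto simp: blinfun.scaleR_right algebra_simps)
      qed
      show "onorm (G' s) \<le> 2 * \<epsilon> * (t * N * N)" if s: "s \<in> {0..t}" for s
      proof (rule onorm_le)
        fix h :: real
        \<comment> \<open>\<open>A\<close> and \<open>B\<close> are the linearisation errors of
          \<open>f'\<close> at two points that differ by t b. In \<open>A - B\<close> the terms
          \<open>f' x\<close> and \<open>f'' (s *\<^sub>R a)\<close> cancel, by linearity of
          \<open>f''\<close>.\<close>
        define A where "A = f' (x + (s *\<^sub>R a + t *\<^sub>R b)) - f' x - f'' (s *\<^sub>R a + t *\<^sub>R b)"
        define B where "B = f' (x + s *\<^sub>R a) - f' x - f'' (s *\<^sub>R a)"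
        have "norm A \<le> \<epsilon> * norm (s *\<^sub>R a + t *\<^sub>R b)" "norm B \<le> \<epsilon> * norm (s *\<^sub>R a)"
          using \<delta>[of "x + (s *\<^sub>R a + t *\<^sub>R b)"] \<delta>[of "x + s *\<^sub>R a"] near[OF s] tN
          by (auto simp: A_def B_def)
        moreover have "\<epsilon> * norm (s *\<^sub>R a + t *\<^sub>R b) \<le> \<epsilon> * (t * N)" "\<epsilon> * norm (s *\<^sub>R a) \<le> \<epsilon> * (t * N)"
          using near[OF s] \<open>\<epsilon> > 0\<close> by (auto intro!: mult_left_mono simp del: norm_scaleR)
        ultimately have AB: "norm (A - B) \<le> 2 * \<epsilon> * (t * N)"
          using norm_triangle_ineq4[of A B] by linarith
        have "G' s h = h *\<^sub>R ((A - B) a)"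
          by (simp add: G'_def A_def B_def blinfun.diff_left blinfun.add_left linear_add[OF lin]
              linear_scale[OF lin] blinfun.scaleR_left algebra_simps)
        then have "norm (G' s h) \<le> norm h * (norm (A - B) * norm a)"
          by (simp add: mult_left_mono norm_blinfun)
        also have "\<dots> \<le> norm h * (2 * \<epsilon> * (t * N) * N)"
          using AB ab \<open>\<epsilon> > 0\<close> \<open>t > 0\<close> \<open>N > 0\<close> by (intro mult_left_mono mult_mono) auto
        finally show "norm (G' s h) \<le> 2 * \<epsilon> * (t * N * N) * norm h"
          by (simp add: mult_ac)
      qed
    qed (use \<open>t > 0\<close> in auto)
    moreover have "G t - G 0 = \<Delta> - (t * t) *\<^sub>R f'' b a"
      by (simp add: G_def \<Delta>)
    ultimately show ?thesis
      using \<open>t > 0\<close> by (simp add: mult_ac)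
  qed
  have k1: "norm (\<Delta> - (t * t) *\<^sub>R f'' v u) \<le> 2 * \<epsilon> * (t * t * N * N)"
    by (rule key) (auto simp: N_def \<Delta>_def)
  have k2: "norm (\<Delta> - (t * t) *\<^sub>R f'' u v) \<le> 2 * \<epsilon> * (t * t * N * N)"
    by (rule key) (auto simp: N_def \<Delta>_def add_ac)
  have "(t * t) * norm (f'' u v - f'' v u)
      = norm ((\<Delta> - (t * t) *\<^sub>R f'' v u) - (\<Delta> - (t * t) *\<^sub>R f'' u v))"
    by (simp flip: scaleR_diff_right)
  also have "\<dots> \<le> 4 * \<epsilon> * (t * t * N * N)"
    by (rule order_trans[OF norm_triangle_ineq4]) (use k1 k2 in linarith)
  also have "\<dots> = (t * t) * (4 / 6 * norm (f'' u v - f'' v u))"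
    using \<open>N > 0\<close> by (simp add: \<epsilon>_def)
  finally have "norm (f'' u v - f'' v u) \<le> 4 / 6 * norm (f'' u v - f'' v u)"
    by (rule mult_left_le_imp_le) (use \<open>t > 0\<close> in simp)
  then show False
    using ne by simp
qed

section \<open>Change of variables\<close>

text \<open>\<open>has_measure_differentiable_image\<close> is an equivalence for each finite value
  m. Used in both directions, it also shows that one side is infinite exactly when the other
  is.\<close>

lemma emeasure_differentiable_image:
  fixes f :: "real^'n::{finite,wellorder} \<Rightarrow> real^'n::_"
  assumes S: "S \<in> sets lebesgue"
    and f: "\<And>x. x \<in> S \<Longrightarrow> (f has_derivative f' x) (at x within S)"
    and inj: "inj_on f S"
  shows "emeasure lebesgue (f ` S) = (\<integral>\<^sup>+x\<in>S. ennreal \<bar>det (matrix (f' x))\<bar> \<partial>lebesgue)"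
proof -
  let ?J = "\<lambda>x. \<bar>det (matrix (f' x))\<bar>"
  have fS: "f ` S \<in> sets lebesgue"
    using S f by (intro differentiable_image_in_sets_lebesgue) (auto simp: differentiable_on_def differentiable_def)
  have J: "?J \<in> borel_measurable (lebesgue_on S)"
    using borel_measurable_det_Jacobian[OF S f] by measurable
  have [measurable]: "(\<lambda>x. if x \<in> S then ?J x else 0) \<in> borel_measurable lebesgue"
    using J S by (simp add: borel_measurable_if)
  have eq: "(\<integral>\<^sup>+x\<in>S. ennreal (?J x) \<partial>lebesgue) = (\<integral>\<^sup>+x. ennreal (if x \<in> S then ?J x else 0) \<partial>lebesgue)"
    by (intro nn_integral_cong) (auto simp: indicator_def)
  have iff: "f ` S \<in> lmeasurable \<and> measure lebesgue (f ` S) = m \<longleftrightarrow>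
      (\<integral>\<^sup>+x\<in>S. ennreal (?J x) \<partial>lebesgue) = ennreal m" if "m \<ge> 0" for m
  proof -
    have "f ` S \<in> lmeasurable \<and> measure lebesgue (f ` S) = m \<longleftrightarrow>
        ((\<lambda>x. if x \<in> S then ?J x else 0) has_integral m) UNIV"
      using has_measure_differentiable_image[OF S f inj] by (simp add: has_integral_restrict_UNIV)
    also have "\<dots> \<longleftrightarrow> (\<integral>\<^sup>+x. ennreal (if x \<in> S then ?J x else 0) \<partial>lebesgue) = ennreal m"
      using that by (subst has_integral_iff_nn_integral_lebesgue) auto
    finally show ?thesis
      by (simp add: eq)
  qed
  show ?thesis
  proof (cases "f ` S \<in> lmeasurable")
    case True
    then show ?thesis
      using iff[of "measure lebesgue (f ` S)"] by (simp add: emeasure_eq_measure2)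
  next
    case False
    then have "(\<integral>\<^sup>+x\<in>S. ennreal (?J x) \<partial>lebesgue) = \<infinity>"
      using iff by (cases "\<integral>\<^sup>+x\<in>S. ennreal (?J x) \<partial>lebesgue" rule: ennreal_cases) auto
    moreover have "emeasure lebesgue (f ` S) = \<infinity>"
      using False fS unfolding fmeasurable_def infinity_ennreal_def by (blast intro: ccontr top.not_eq_extremum[THEN iffD1])
    ultimately show ?thesis
      by simp
  qed
qed

section \<open>Lebesgue measure and Jacobians in the real coordinates of the group\<close>

definition vec_to_heis :: "real^3 \<Rightarrow> heis" where
  "vec_to_heis v = (Complex (v $ 1) (v $ 2), v $ 3)"

definition heis_to_vec :: "heis \<Rightarrow> real^3" where
  "heis_to_vec p = vector [Re (fst p), Im (fst p), snd p]"

lemma heis_to_vec_nth [simp]: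
  "heis_to_vec p $ 1 = Re (fst p)" "heis_to_vec p $ 2 = Im (fst p)" "heis_to_vec p $ 3 = snd p"
  by (simp_all add: heis_to_vec_def)

lemma vec_to_heis_inverse [simp]: "heis_to_vec (vec_to_heis v) = v"
  by (simp add: vec_eq_iff forall_3 vec_to_heis_def)

lemma heis_to_vec_inverse [simp]: "vec_to_heis (heis_to_vec p) = p"
  by (simp add: vec_to_heis_def)

lemma bounded_linear_vec_to_heis: "bounded_linear vec_to_heis"
  by (rule linear_conv_bounded_linear[THEN iffD1], rule linearI)
     (auto simp: vec_to_heis_def complex_eq_iff)

lemma bounded_linear_heis_to_vec: "bounded_linear heis_to_vec"
  by (rule linear_conv_bounded_linear[THEN iffD1], rule linearI)
     (auto simp: vec_eq_iff forall_3)

lemma measurable_vec_to_heis [measurable]: "vec_to_heis \<in> borel \<rightarrow>\<^sub>M borel"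
  by (intro borel_measurable_continuous_onI linear_continuous_on bounded_linear_vec_to_heis)

lemma Basis_heis: "(Basis :: heis set) = {(1, 0), (\<i>, 0), (0, 1)}"
  by (auto simp: Basis_prod_def Basis_complex_def)

lemma Basis_vec_3: "(Basis :: (real^3) set) = {axis 1 1, axis 2 1, axis 3 1}"
  by (auto simp: Basis_vec_def UNIV_3)

text \<open>Preimages of boxes are boxes with the same edge lengths, and the volumes of boxes
  determine Lebesgue measure.\<close>

lemma distr_lborel_vec_to_heis: "distr lborel borel vec_to_heis = lborel"
proof (rule lborel_eqI[symmetric])
  fix l u :: heis
  assume le: "\<And>b. b \<in> Basis \<Longrightarrow> l \<bullet> b \<le> u \<bullet> b"
  have "vec_to_heis -` box l u = box (heis_to_vec l) (heis_to_vec u)"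
    by (auto simp: mem_box Basis_heis Basis_vec_3 inner_axis vec_to_heis_def inner_prod_def)
  then have "emeasure (distr lborel borel vec_to_heis) (box l u)
      = emeasure lborel (box (heis_to_vec l) (heis_to_vec u))"
    by (simp add: emeasure_distr)
  also have "\<dots> = (\<Prod>b\<in>Basis. (heis_to_vec u - heis_to_vec l) \<bullet> b)"
    using le[of "(1, 0)"] le[of "(\<i>, 0)"] le[of "(0, 1)"]
    by (intro emeasure_lborel_box) (auto simp: Basis_heis Basis_vec_3 inner_axis inner_prod_def)
  also have "\<dots> = (\<Prod>b\<in>Basis. (u - l) \<bullet> b)"
    by (simp add: Basis_heis Basis_vec_3 axis_eq_axis inner_axis inner_prod_def)
  finally show "emeasure (distr lborel borel vec_to_heis) (box l u) = (\<Prod>b\<in>Basis. (u - l) \<bullet> b)" .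
qed simp

text \<open>\<open>det\<close> and the image formula live on \<open>real^3\<close>, so
  \<open>L\<close> is conjugated by the coordinate map.\<close>

definition heis_jacobian :: "(heis \<Rightarrow> heis) \<Rightarrow> real" where
  "heis_jacobian L = det (matrix (\<lambda>v. heis_to_vec (L (vec_to_heis v))))"

lemma heis_jacobian_eq:
  "heis_jacobian L =
     Re (fst (L (1, 0))) * Im (fst (L (\<i>, 0))) * snd (L (0, 1)) +
     Re (fst (L (\<i>, 0))) * Im (fst (L (0, 1))) * snd (L (1, 0)) +
     Re (fst (L (0, 1))) * Im (fst (L (1, 0))) * snd (L (\<i>, 0)) -
     Re (fst (L (1, 0))) * Im (fst (L (0, 1))) * snd (L (\<i>, 0)) -
     Re (fst (L (\<i>, 0))) * Im (fst (L (1, 0))) * snd (L (0, 1)) -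
     Re (fst (L (0, 1))) * Im (fst (L (\<i>, 0))) * snd (L (1, 0))"
proof -
  have "vec_to_heis (axis 1 1) = (1, 0)" "vec_to_heis (axis 2 1) = (\<i>, 0)"
    "vec_to_heis (axis 3 1) = (0, 1)"
    by (auto simp: vec_to_heis_def axis_def complex_eq_iff)
  then show ?thesis
    by (simp add: heis_jacobian_def det_3 matrix_def)
qed

text \<open>The formula on \<open>real^3\<close> is transported along the measure preserving map
  \<open>vec_to_heis\<close>. Borel sets are used so that \<open>lborel\<close> and
  \<open>lebesgue\<close> agree on them.\<close>

lemma emeasure_heis_image:
  assumes S: "S \<in> sets borel" and fS: "f ` S \<in> sets borel"
    and f: "\<And>p. p \<in> S \<Longrightarrow> (f has_derivative f' p) (at p)" and inj: "inj_on f S"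
    and J: "(\<lambda>p. heis_jacobian (f' p)) \<in> borel_measurable (restrict_space borel S)"
  shows "emeasure lborel (f ` S) = (\<integral>\<^sup>+p\<in>S. ennreal \<bar>heis_jacobian (f' p)\<bar> \<partial>lborel)"
proof -
  define F where "F = (\<lambda>v. heis_to_vec (f (vec_to_heis v)))"
  define F' where "F' v = (\<lambda>u. heis_to_vec (f' (vec_to_heis v) (vec_to_heis u)))" for v
  let ?S = "vec_to_heis -` S"
  have S': "?S \<in> sets borel"
    using measurable_sets_borel[OF measurable_vec_to_heis S] by simp
  have img: "vec_to_heis -` (f ` S) = F ` ?S"
  proof (intro set_eqI iffI)
    fix v assume "v \<in> vec_to_heis -` (f ` S)"
    then obtain p where "p \<in> S" "vec_to_heis v = f p" by auto
    then have "v = F (heis_to_vec p)"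
      by (simp add: F_def flip: \<open>vec_to_heis v = f p\<close>)
    then show "v \<in> F ` ?S"
      using \<open>p \<in> S\<close> by (auto intro!: image_eqI)
  qed (auto simp: F_def)
  have [measurable]: "(\<lambda>p. ennreal \<bar>heis_jacobian (f' p)\<bar> * indicator S p) \<in> borel_measurable borel"
    using J S by (subst borel_measurable_restrict_space_iff_ennreal[symmetric]) auto
  have "emeasure lborel (f ` S) = emeasure (distr lborel borel vec_to_heis) (f ` S)"
    by (simp add: distr_lborel_vec_to_heis)
  also have "\<dots> = emeasure lborel (F ` ?S)"
    using fS by (simp add: emeasure_distr img)
  also have "\<dots> = emeasure lebesgue (F ` ?S)"
    using measurable_sets_borel[OF measurable_vec_to_heis fS] by (simp add: img)
  also have "\<dots> = (\<integral>\<^sup>+v\<in>?S. ennreal \<bar>det (matrix (F' v))\<bar> \<partial>lebesgue)"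
  proof (rule emeasure_differentiable_image)
    show "?S \<in> sets lebesgue"
      using S' by simp
    show "(F has_derivative F' v) (at v within ?S)" if "v \<in> ?S" for v
    proof -
      have 1: "(vec_to_heis has_derivative vec_to_heis) (at v within ?S)"
        by (rule bounded_linear_imp_has_derivative[OF bounded_linear_vec_to_heis])
      have "((\<lambda>v. f (vec_to_heis v)) has_derivative (\<lambda>u. f' (vec_to_heis v) (vec_to_heis u))) (at v within ?S)"
        using that by (intro has_derivative_compose[OF 1] f) auto
      then show ?thesis
        unfolding F_def F'_def by (rule bounded_linear.has_derivative[OF bounded_linear_heis_to_vec])
    qed
    show "inj_on F ?S"
      using inj unfolding F_def inj_on_def by (metis heis_to_vec_inverse vec_to_heis_inverse vimageE)
  qed
  also have "\<dots> = (\<integral>\<^sup>+v. ennreal \<bar>heis_jacobian (f' (vec_to_heis v))\<bar> * indicator S (vec_to_heis v) \<partial>lborel)"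
    by (simp add: nn_integral_completion heis_jacobian_def F'_def indicator_vimage)
  also have "\<dots> = (\<integral>\<^sup>+p\<in>S. ennreal \<bar>heis_jacobian (f' p)\<bar> \<partial>distr lborel borel vec_to_heis)"
    by (subst nn_integral_distr) auto
  finally show ?thesis
    by (simp add: distr_lborel_vec_to_heis)
qed

text \<open>\<open>f\<close> pushes the measure on \<open>A\<close> with density |J| to Lebesgue
  measure on \<open>B\<close>: the mass of a Borel set \<open>E\<close> is the integral of |J| over
  its preimage, which is the volume of \<open>E\<close> by \<open>emeasure_heis_image\<close>.
  Integrating \<open>F\<close> against both measures gives the formula.\<close>

lemma nn_integral_heis_change_of_variables:
  assumes "open A" "open B" and hom: "homeomorphism A B f h"
    and f: "\<And>p. p \<in> A \<Longrightarrow> (f has_derivative f' p) (at p)"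
    and J: "(\<lambda>p. heis_jacobian (f' p)) \<in> borel_measurable (restrict_space borel A)"
    and F: "F \<in> borel_measurable (restrict_space borel B)"
  shows "(\<integral>\<^sup>+q\<in>B. F q \<partial>lborel) = (\<integral>\<^sup>+p\<in>A. F (f p) * ennreal \<bar>heis_jacobian (f' p)\<bar> \<partial>lborel)"
proof -
  let ?A = "restrict_space lborel A" and ?B = "restrict_space lborel B"
  have [measurable]: "A \<in> sets borel" "B \<in> sets borel"
    using assms by auto
  have [simp]: "sets (restrict_space lborel C) = sets (restrict_space borel C)" for C :: "heis set"
    by (simp add: sets_restrict_space)
  have [measurable]: "f \<in> ?A \<rightarrow>\<^sub>M ?B"
    using hom borel_measurable_continuous_on_restrict[of A f]
    by (auto simp: homeomorphism_def measurable_restrict_space2_iff space_restrict_space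
        cong: measurable_cong_sets)
  have [measurable]: "(\<lambda>p. heis_jacobian (f' p)) \<in> borel_measurable ?A" "F \<in> borel_measurable ?B"
    using J F by (simp_all cong: measurable_cong_sets)
  define M where "M = density ?A (\<lambda>p. ennreal \<bar>heis_jacobian (f' p)\<bar>)"
  have "distr M ?B f = ?B"
  proof (rule measure_eqI)
    fix E assume "E \<in> sets (distr M ?B f)"
    then have E: "E \<in> sets borel" "E \<subseteq> B"
      by (auto simp: sets_restrict_space)
    define S where "S = A \<inter> f -` E"
    have S: "S \<in> sets borel"
    proof -
      have "E \<in> sets ?B"
        using E by (auto simp: sets_restrict_space)
      from measurable_sets[OF \<open>f \<in> ?A \<rightarrow>\<^sub>M ?B\<close> this] show ?thesis
        by (auto simp: S_def sets_restrict_space space_restrict_space Int_commute)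
    qed
    have fS: "f ` S = E"
      using hom E by (force simp: S_def homeomorphism_def)
    have "emeasure (distr M ?B f) E = (\<integral>\<^sup>+p\<in>S. ennreal \<bar>heis_jacobian (f' p)\<bar> \<partial>lborel)"
    proof -
      have "emeasure (distr M ?B f) E = emeasure M (f -` E \<inter> space ?A)"
        using E by (subst emeasure_distr) (auto simp: M_def sets_restrict_space)
      also have "\<dots> = (\<integral>\<^sup>+p. ennreal \<bar>heis_jacobian (f' p)\<bar> * indicator (f -` E \<inter> space ?A) p \<partial>?A)"
        unfolding M_def using E by (intro emeasure_density measurable_sets[where A = ?B]) (auto simp: sets_restrict_space)
      also have "\<dots> = (\<integral>\<^sup>+p\<in>S. ennreal \<bar>heis_jacobian (f' p)\<bar> \<partial>lborel)"
        by (auto simp: nn_integral_restrict_space S_def space_restrict_space indicator_def intro!: nn_integral_cong)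
      finally show ?thesis .
    qed
    also have "\<dots> = emeasure lborel (f ` S)"
      using S E fS f hom by (intro emeasure_heis_image[symmetric]) 
        (auto simp: S_def homeomorphism_def intro: inj_on_inverseI[of _ h] measurable_restrict_mono[OF J])
    finally show "emeasure (distr M ?B f) E = emeasure ?B E"
      using E by (simp add: fS emeasure_restrict_space)
  qed simp
  then have "(\<integral>\<^sup>+q\<in>B. F q \<partial>lborel) = (\<integral>\<^sup>+q. F q \<partial>distr M ?B f)"
    by (simp add: nn_integral_restrict_space)
  also have "\<dots> = (\<integral>\<^sup>+p. F (f p) \<partial>M)"
    by (rule nn_integral_distr) (auto simp: M_def)
  also have "\<dots> = (\<integral>\<^sup>+p. ennreal \<bar>heis_jacobian (f' p)\<bar> * F (f p) \<partial>?A)"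
    unfolding M_def by (rule nn_integral_density) auto
  also have "\<dots> = (\<integral>\<^sup>+p\<in>A. F (f p) * ennreal \<bar>heis_jacobian (f' p)\<bar> \<partial>lborel)"
    by (simp add: nn_integral_restrict_space mult_ac)
  finally show ?thesis .
qed

section \<open>Contact maps\<close>

text \<open>With z = x + i y, \<open>X_vec\<close> and \<open>Y_vec\<close> are the left-invariant
  fields d_x + 2 y d_t and d_y - 2 x d_t. They span the kernel of omega, and Z = (X - i Y) / 2, Zbar
  = (X + i Y) / 2.\<close>

definition X_vec :: "heis \<Rightarrow> heis" where
  "X_vec p = (1, 2 * Im (fst p))"

definition Y_vec :: "heis \<Rightarrow> heis" where
  "Y_vec p = (\<i>, - 2 * Re (fst p))"

text \<open>The form \<open>\<omega>\<close> at \<open>q\<close>.\<close>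

definition contact_form :: "heis \<Rightarrow> heis \<Rightarrow> real" where
  "contact_form q v = snd v + 2 * Im (cnj (fst q) * fst v)"

text \<open>\<open>f' p\<close> has to map the horizontal plane at \<open>p\<close> into the one at
  \<open>f p\<close>. Then f pulls omega back to lambda omega with lambda =
  \<open>contact_form (f p) (f' p (0, 1))\<close>, which is allowed to vanish.\<close>

definition contact_on :: "heis set \<Rightarrow> (heis \<Rightarrow> heis) \<Rightarrow> (heis \<Rightarrow> heis \<Rightarrow> heis) \<Rightarrow> bool" where
  "contact_on A f f' \<longleftrightarrow> (\<forall>p\<in>A. contact_form (f p) (f' p (X_vec p)) = 0 \<and>
     contact_form (f p) (f' p (Y_vec p)) = 0)"

lemma linear_X_vec: "linear L \<Longrightarrow> L (X_vec p) = L (1, 0) + (2 * Im (fst p)) *\<^sub>R L (0, 1)"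
  and linear_Y_vec: "linear L \<Longrightarrow> L (Y_vec p) = L (\<i>, 0) - (2 * Re (fst p)) *\<^sub>R L (0, 1)"
  by (simp_all add: X_vec_def Y_vec_def flip: linear_add linear_diff linear_scale)

lemma
  assumes u: "(u has_derivative D) (at p)"
  shows Z_op_eq: "Z_op u p = (D (X_vec p) - \<i> * D (Y_vec p)) / 2"
    and Zbar_op_eq: "Zbar_op u p = (D (X_vec p) + \<i> * D (Y_vec p)) / 2"
proof -
  have D: "frechet_derivative u (at p) = D"
    using frechet_derivative_at[OF u] by simp
  have lin: "linear D"
    using u has_derivative_linear by blast
  show "Z_op u p = (D (X_vec p) - \<i> * D (Y_vec p)) / 2"
    "Zbar_op u p = (D (X_vec p) + \<i> * D (Y_vec p)) / 2"
    by (simp_all add: Z_op_def Zbar_op_def D linear_X_vec[OF lin] linear_Y_vec[OF lin] Let_def complex_eq_iff field_simps)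
qed

text \<open>d(t + i |z|^2) = omega + 2 i conj(z) dz. On horizontal vectors only the second term is
  left; the contact and the lifting arguments both rest on this splitting.\<close>

lemma has_derivative_Pi_comp:
  fixes f D :: "_ \<Rightarrow> heis"
  assumes f: "(f has_derivative D) (at p within S)"
  shows
  "((\<lambda>p. Pi_proj (f p)) has_derivative
     (\<lambda>v. of_real (contact_form (f p) (D v)) + 2 * \<i> * cnj (fst (f p)) * fst (D v))) (at p within S)"
proof -
  have "((\<lambda>p. of_real (snd (f p)) + \<i> * (fst (f p) * cnj (fst (f p)))) has_derivative
      (\<lambda>v. of_real (snd (D v)) + \<i> * (fst (f p) * cnj (fst (D v)) + fst (D v) * cnj (fst (f p))))) (at p within S)"
    by (intro has_derivative_add has_derivative_mult has_derivative_mult_right has_derivative_of_real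
        has_derivative_cnj has_derivative_fst has_derivative_snd f)
  moreover have "(\<lambda>p. of_real (snd (f p)) + \<i> * (fst (f p) * cnj (fst (f p)))) = (\<lambda>p. Pi_proj (f p))"
    by (simp add: Pi_proj_def complex_norm_square[symmetric] del: of_real_power)
  moreover have "(\<lambda>v. of_real (snd (D v)) + \<i> * (fst (f p) * cnj (fst (D v)) + fst (D v) * cnj (fst (f p))))
      = (\<lambda>v. of_real (contact_form (f p) (D v)) + 2 * \<i> * cnj (fst (f p)) * fst (D v))"
    by (auto simp: contact_form_def complex_eq_iff algebra_simps)
  ultimately show ?thesis
    by simp
qed

context
  fixes f :: "heis \<Rightarrow> heis" and D :: "heis \<Rightarrow> heis" and p :: heis
  assumes f: "(f has_derivative D) (at p)"
begin

lemma has_derivative_fst_comp: "((\<lambda>p. fst (f p)) has_derivative (\<lambda>v. fst (D v))) (at p)"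
  using f by (rule has_derivative_fst)

lemma Z_op_fst: "Z_op (\<lambda>p. fst (f p)) p = (fst (D (X_vec p)) - \<i> * fst (D (Y_vec p))) / 2"
  and Zbar_op_fst: "Zbar_op (\<lambda>p. fst (f p)) p = (fst (D (X_vec p)) + \<i> * fst (D (Y_vec p))) / 2"
  by (rule Z_op_eq Zbar_op_eq, rule has_derivative_fst_comp)+

lemma Z_op_Pi:
    "Z_op (\<lambda>p. Pi_proj (f p)) p =
       (of_real (contact_form (f p) (D (X_vec p))) - \<i> * of_real (contact_form (f p) (D (Y_vec p)))) / 2
       + 2 * \<i> * cnj (fst (f p)) * Z_op (\<lambda>p. fst (f p)) p"
  and Zbar_op_Pi:
    "Zbar_op (\<lambda>p. Pi_proj (f p)) p =
       (of_real (contact_form (f p) (D (X_vec p))) + \<i> * of_real (contact_form (f p) (D (Y_vec p)))) / 2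
       + 2 * \<i> * cnj (fst (f p)) * Zbar_op (\<lambda>p. fst (f p)) p"
  unfolding Z_op_eq[OF has_derivative_Pi_comp[OF f]] Zbar_op_eq[OF has_derivative_Pi_comp[OF f]] Z_op_fst Zbar_op_fst
  by (simp_all add: field_simps)

text \<open>For \<open>h = Pi_proj \<circ> f\<close> one has \<open>Z h - 2 i cnj f\<^sub>1 Z f\<^sub>1 = \<omega>(f\<^sub>* Z)\<close>, and \<open>\<omega>(f\<^sub>* Zbar)\<close>
  is its complex conjugate since \<open>\<omega>\<close> is real. So both Beltrami equations with the same
  \<open>\<mu>\<close> force it to vanish.\<close>

lemma beltrami_imp_contact:
  assumes "Zbar_op (\<lambda>p. fst (f p)) p = \<mu> * Z_op (\<lambda>p. fst (f p)) p"
    and "Zbar_op (\<lambda>p. Pi_proj (f p)) p = \<mu> * Z_op (\<lambda>p. Pi_proj (f p)) p"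
    and "cmod \<mu> < 1"
  shows "contact_form (f p) (D (X_vec p)) = 0" "contact_form (f p) (D (Y_vec p)) = 0"
proof -
  define a where "a = contact_form (f p) (D (X_vec p))"
  define b where "b = contact_form (f p) (D (Y_vec p))"
  \<comment> \<open>By the first Beltrami equation the terms with f1 cancel in the second, and only
    the values of omega remain.\<close>
  have "(of_real a + \<i> * of_real b) / 2 = \<mu> * ((of_real a - \<i> * of_real b) / 2)"
    using assms(2) unfolding Z_op_Pi Zbar_op_Pi assms(1) a_def b_def by (simp add: algebra_simps)
  then have "of_real a + \<i> * of_real b = \<mu> * (of_real a - \<i> * of_real b)"
    by (simp only: times_divide_eq_right divide_cancel_right) simp
  then have eq: "Complex a b = \<mu> * cnj (Complex a b)"
    by (simp add: complex_eq_iff)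
  then have "cmod (Complex a b) = cmod \<mu> * cmod (Complex a b)"
    by (metis complex_mod_cnj norm_mult)
  then have "Complex a b = 0"
    using assms(3) by auto
  then show "contact_form (f p) (D (X_vec p)) = 0" "contact_form (f p) (D (Y_vec p)) = 0"
    by (simp_all add: a_def b_def complex_eq_iff)
qed

end

text \<open>Z Pi = 2 i conj(z) and Zbar Pi = 0, so Z also annihilates the conjugate of Pi. In the
  chain rule only \<open>d_w g\<close> survives under Z and only \<open>d_wbar g\<close> under
  Zbar.\<close>

lemma Z_op_comp_Pi:
  assumes g: "(g has_derivative D) (at (Pi_proj p))"
  shows "Z_op (\<lambda>p. g (Pi_proj p)) p = 2 * \<i> * cnj (fst p) * d_w g (Pi_proj p)"
    and "Zbar_op (\<lambda>p. g (Pi_proj p)) p = cnj (2 * \<i> * cnj (fst p)) * d_wbar g (Pi_proj p)"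
proof -
  have lin: "linear D"
    using g has_derivative_linear by blast
  have D: "frechet_derivative g (at (Pi_proj p)) = D"
    using frechet_derivative_at[OF g] by simp
  have Dc: "D c = of_real (Re c) * D 1 + of_real (Im c) * D \<i>" for c
  proof -
    have "D c = D (Re c *\<^sub>R 1 + Im c *\<^sub>R \<i>)"
      by (rule arg_cong[of _ _ D]) (simp add: complex_eq_iff)
    then show ?thesis
      unfolding linear_add[OF lin] linear_scale[OF lin] by (simp add: scaleR_conv_of_real)
  qed
  have "((\<lambda>q. g (Pi_proj q)) has_derivative
      (\<lambda>v. D (of_real (contact_form p v) + 2 * \<i> * cnj (fst p) * fst v))) (at p)"
    by (rule has_derivative_compose[OF has_derivative_Pi_comp[OF has_derivative_ident] g])
  note Z_op_eq[OF this] Zbar_op_eq[OF this]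
  then show "Z_op (\<lambda>p. g (Pi_proj p)) p = 2 * \<i> * cnj (fst p) * d_w g (Pi_proj p)"
    and "Zbar_op (\<lambda>p. g (Pi_proj p)) p = cnj (2 * \<i> * cnj (fst p)) * d_wbar g (Pi_proj p)"
    unfolding d_w_def d_wbar_def D Let_def
      Dc[of "of_real (contact_form p (X_vec p)) + 2 * \<i> * cnj (fst p) * fst (X_vec p)"]
      Dc[of "of_real (contact_form p (Y_vec p)) + 2 * \<i> * cnj (fst p) * fst (Y_vec p)"]
    by (simp_all only:) (simp_all add: contact_form_def X_vec_def Y_vec_def complex_eq_iff field_simps)
qed

text \<open>The Lie bracket of \<open>X\<close> and \<open>Y\<close> is a multiple of \<open>\<partial>\<^sub>t\<close>: differentiate the contact equations
  along \<open>X\<close> and \<open>Y\<close> and subtract.\<close>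

lemma contact_form_vertical:
  fixes f :: "heis \<Rightarrow> heis" and f' :: "heis \<Rightarrow> heis \<Rightarrow>\<^sub>L heis" and f'' :: "heis \<Rightarrow> heis \<Rightarrow>\<^sub>L heis"
  assumes A: "open A" "p \<in> A"
    and f: "\<And>q. q \<in> A \<Longrightarrow> (f has_derivative f' q) (at q)"
    and f'': "(f' has_derivative f'') (at p)"
    and contact: "contact_on A f (\<lambda>q. blinfun_apply (f' q))"
  shows "contact_form (f p) (f' p (0, 1)) = Im (cnj (fst (f' p (X_vec p))) * fst (f' p (Y_vec p)))"
proof -
  note second_sym = symmetric_second_derivative[OF A f f'']
  note app = blinfun.FDERIV[OF f'']
  have dX: "(X_vec has_derivative (\<lambda>v. (0, 2 * Im (fst v)))) (at p)"
    unfolding X_vec_def by (intro has_derivative_Pair has_derivative_const has_derivative_mult_right has_derivative_Im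
        has_derivative_fst has_derivative_ident)
  have dY: "(Y_vec has_derivative (\<lambda>v. (0, - 2 * Re (fst v)))) (at p)"
    unfolding Y_vec_def by (intro has_derivative_Pair has_derivative_const has_derivative_mult_right has_derivative_Re
        has_derivative_fst has_derivative_ident)
  \<comment> \<open>The summand with the factor 2 comes from moving the base point
    \<open>f q\<close> of the form.\<close>
  have diff0: "contact_form (f p) (f'' v (V p) + f' p (V' v)) + 2 * Im (cnj (fst (f' p v)) * fst (f' p (V p))) = 0"
    if V: "(V has_derivative V') (at p)" and 0: "\<And>q. q \<in> A \<Longrightarrow> contact_form (f q) (f' q (V q)) = 0" for V V' v
  proof -
    have "((\<lambda>q. contact_form (f q) (f' q (V q))) has_derivative
       (\<lambda>v. contact_form (f p) (f'' v (V p) + f' p (V' v)) + 2 * Im (cnj (fst (f' p v)) * fst (f' p (V p))))) (at p)"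
      unfolding contact_form_def
      by (rule has_derivative_eq_rhs[OF has_derivative_add[OF has_derivative_snd[OF app[OF V]]
            has_derivative_mult_right[OF has_derivative_Im[OF has_derivative_mult[OF
              has_derivative_cnj[OF has_derivative_fst[OF f[OF A(2)]]] has_derivative_fst[OF app[OF V]]]]]]])
         (simp add: fun_eq_iff distrib_left add.commute)
    moreover have "((\<lambda>q. contact_form (f q) (f' q (V q))) has_derivative (\<lambda>v. 0)) (at p)"
      by (rule has_derivative_transform_within_open[OF has_derivative_const A]) (simp add: 0)
    ultimately show ?thesis
      using has_derivative_unique by (blast dest: fun_cong)
  qed
  \<comment> \<open>X differentiated along Y gives 2 d_t, and Y along X gives -2 d_t. In the
    difference of \<open>1\<close> and \<open>2\<close> the second derivatives cancel by symmetry,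
    which leaves four times the claim.\<close>
  have 1: "contact_form (f p) (f'' (Y_vec p) (X_vec p) + 2 *\<^sub>R f' p (0, 1))
      + 2 * Im (cnj (fst (f' p (Y_vec p))) * fst (f' p (X_vec p))) = 0"
    using diff0[OF dX, of "Y_vec p"] contact
    by (simp add: contact_on_def Y_vec_def flip: blinfun.scaleR_right)
  have 2: "contact_form (f p) (f'' (X_vec p) (Y_vec p) - 2 *\<^sub>R f' p (0, 1))
      + 2 * Im (cnj (fst (f' p (X_vec p))) * fst (f' p (Y_vec p))) = 0"
    using diff0[OF dY, of "X_vec p"] contact blinfun.minus_right[of "f' p" "(0, 2)"]
    by (simp add: contact_on_def X_vec_def flip: blinfun.scaleR_right)
  from 1 2 show ?thesis
    by (simp add: second_sym[of "Y_vec p" "X_vec p"] contact_form_def algebra_simps)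
qed

text \<open>Passing to the frame X, Y, d_t in the source and from dt to omega in the target does not
  change the determinant. There the matrix is block triangular, with the planar determinant
  Im(conj(a) b) as horizontal block, for a and b the \<open>fst\<close> components of
  \<open>L (X_vec p)\<close> and \<open>L (Y_vec p)\<close>.\<close>

lemma heis_jacobian_contact:
  assumes lin: "linear L" and X: "contact_form q (L (X_vec p)) = 0" and Y: "contact_form q (L (Y_vec p)) = 0"
  shows "heis_jacobian L = contact_form q (L (0, 1)) * Im (cnj (fst (L (X_vec p))) * fst (L (Y_vec p)))"
proof -
  have 1: "L (1, 0) = L (X_vec p) - (2 * Im (fst p)) *\<^sub>R L (0, 1)"
      "L (\<i>, 0) = L (Y_vec p) + (2 * Re (fst p)) *\<^sub>R L (0, 1)"
    by (simp_all add: linear_X_vec[OF lin] linear_Y_vec[OF lin])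
  have 2: "snd (L (X_vec p)) = - 2 * Im (cnj (fst q) * fst (L (X_vec p)))"
     "snd (L (Y_vec p)) = - 2 * Im (cnj (fst q) * fst (L (Y_vec p)))"
    using X Y by (simp_all add: contact_form_def)
  show ?thesis
    unfolding heis_jacobian_eq contact_form_def 1
    by (simp only: fst_add fst_diff snd_add snd_diff fst_scaleR snd_scaleR 2 complex.sel
       plus_complex.sel minus_complex.sel scaleR_complex.sel times_complex.sel cnj.sel real_scaleR_def) algebra
qed

text \<open>The set where \<open>u\<close> differs from \<open>c\<close> is open and null, hence
  empty.\<close>

lemma continuous_on_AE_zero:
  fixes u :: "'a::euclidean_space \<Rightarrow> 'b::t1_space"
  assumes "open A" "continuous_on A u" "AE p in lebesgue_on A. u p = c" "p \<in> A"
  shows "u p = c"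
proof (rule ccontr)
  assume "u p \<noteq> c"
  let ?N = "A \<inter> u -` (- {c})"
  have op: "open ?N"
    using assms by (intro continuous_open_preimage) auto
  have "AE q in lebesgue. q \<in> A \<longrightarrow> u q = c"
    using assms by (subst AE_restrict_space_iff[symmetric]) auto
  then have "negligible ?N"
    using op by (auto simp: negligible_iff_null_sets AE_iff_null_sets elim!: eventually_mono)
  then show False
    using open_not_negligible[OF op] \<open>u p \<noteq> c\<close> \<open>p \<in> A\<close> by auto
qed

section \<open>Horizontal curves\<close>

lemma at_within_interval_neq_bot:
  fixes I :: "real set"
  assumes "is_interval I" "interior I \<noteq> {}" "s \<in> I"
  shows "at s within I \<noteq> bot"
proof -
  have "\<not> (\<exists>x. I = {x})"
    using assms by auto
  then show ?thesis
    using assms connected_imp_perfect[of I s] by (auto simp: is_interval_connected trivial_limit_within)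
qed

text \<open>Derivatives within a nondegenerate interval are unique, so the
  \<open>vector_derivative\<close> of each component is that component of \<open>D\<close>, and
  horizontality becomes a condition on \<open>D\<close> alone.\<close>

lemma horizontal_curve_iff:
  "horizontal_curve (I, \<gamma>) \<longleftrightarrow> is_interval I \<and> interior I \<noteq> {} \<and>
     (\<exists>D. continuous_on I D \<and> (\<forall>s\<in>I. (\<gamma> has_vector_derivative D s) (at s within I) \<and>
        contact_form (\<gamma> s) (D s) = 0))"
proof -
  have eq: "vector_derivative (snd \<circ> \<gamma>) (at s within I) =
        - 2 * Im (cnj (fst (\<gamma> s)) * vector_derivative (fst \<circ> \<gamma>) (at s within I))
      \<longleftrightarrow> contact_form (\<gamma> s) (D s) = 0"
    if I: "is_interval I" "interior I \<noteq> {}" "s \<in> I" and D: "(\<gamma> has_vector_derivative D s) (at s within I)" for D s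
  proof -
    have "vector_derivative (fst \<circ> \<gamma>) (at s within I) = fst (D s)"
      unfolding o_def
      by (rule vector_derivative_within[OF at_within_interval_neq_bot[OF I]
          bounded_linear.has_vector_derivative[OF bounded_linear_fst D]])
    moreover have "vector_derivative (snd \<circ> \<gamma>) (at s within I) = snd (D s)"
      unfolding o_def
      by (rule vector_derivative_within[OF at_within_interval_neq_bot[OF I]
          bounded_linear.has_vector_derivative[OF bounded_linear_snd D]])
    ultimately show ?thesis
      by (simp only: contact_form_def) linarith
  qed
  show ?thesis
    unfolding horizontal_curve.simps C1_curve.simps using eq by meson
qed

text \<open>A horizontal vector is a combination of X and Y, with the real and imaginary parts of
  its \<open>fst\<close> component as coefficients.\<close>

lemma contact_form_horizontal:
  assumes "linear L" "contact_form q (L (X_vec p)) = 0" "contact_form q (L (Y_vec p)) = 0"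
    and v: "contact_form p v = 0"
  shows "contact_form q (L v) = 0"
proof -
  define x y where "x = Re (fst v)" and "y = Im (fst v)"
  have "fst v = Complex x y" "snd v = 2 * Im (fst p) * x - 2 * Re (fst p) * y"
    using v by (simp_all add: x_def y_def contact_form_def)
  then have "v = x *\<^sub>R X_vec p + y *\<^sub>R Y_vec p"
    by (simp add: X_vec_def Y_vec_def prod_eq_iff complex_eq_iff)
  then have "L v = x *\<^sub>R L (X_vec p) + y *\<^sub>R L (Y_vec p)"
    by (simp only: linear_add[OF assms(1)] linear_scale[OF assms(1)])
  then have "contact_form q (L v) =
      x * contact_form q (L (X_vec p)) + y * contact_form q (L (Y_vec p))"
    by (simp add: contact_form_def algebra_simps)
  then show ?thesis
    using assms by simp
qed

lemma horizontal_curve_image: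
  fixes f' :: "heis \<Rightarrow> heis \<Rightarrow>\<^sub>L heis"
  assumes \<gamma>: "horizontal_curve (I, \<gamma>)" and A: "\<gamma> ` I \<subseteq> A"
    and f: "\<And>p. p \<in> A \<Longrightarrow> (f has_derivative f' p) (at p)" and f': "continuous_on A f'"
    and contact: "contact_on A f (\<lambda>p. blinfun_apply (f' p))"
  shows "horizontal_curve (I, f \<circ> \<gamma>)"
proof -
  obtain D where I: "is_interval I" "interior I \<noteq> {}" and D: "continuous_on I D"
    and \<gamma>': "\<And>s. s \<in> I \<Longrightarrow> (\<gamma> has_vector_derivative D s) (at s within I)"
    and hor: "\<And>s. s \<in> I \<Longrightarrow> contact_form (\<gamma> s) (D s) = 0"
    using \<gamma> unfolding horizontal_curve_iff by blast
  have "continuous_on I \<gamma>"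
    using \<gamma>' by (auto simp: continuous_on_eq_continuous_within intro: has_vector_derivative_continuous)
  then have "continuous_on I (\<lambda>s. f' (\<gamma> s) (D s))"
    using A D by (intro continuous_intros continuous_on_compose2[OF f'])
  moreover have "(f \<circ> \<gamma> has_vector_derivative f' (\<gamma> s) (D s)) (at s within I)" if "s \<in> I" for s
  proof -
    have "\<gamma> s \<in> A"
      using A that by blast
    from has_derivative_compose[OF \<gamma>'[OF that, unfolded has_vector_derivative_def] f[OF this]]
    show ?thesis
      by (simp only: has_vector_derivative_def o_def blinfun.scaleR_right)
  qed
  moreover have "contact_form ((f \<circ> \<gamma>) s) (f' (\<gamma> s) (D s)) = 0" if "s \<in> I" for s
  proof -
    have "\<gamma> s \<in> A"
      using A that by blast
    then have "contact_form (f (\<gamma> s)) (f' (\<gamma> s) (X_vec (\<gamma> s))) = 0" "contact_form (f (\<gamma> s)) (f' (\<gamma> s) (Y_vec (\<gamma> s))) = 0"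
      using contact by (simp_all only: contact_on_def)
    from contact_form_horizontal[OF bounded_linear.linear[OF blinfun.bounded_linear_right] this hor[OF that]]
    show ?thesis
      by simp
  qed
  ultimately show ?thesis
    using I unfolding horizontal_curve_iff by blast
qed

lemma has_vector_derivative_Pi_horizontal:
  assumes "(\<gamma> has_vector_derivative D) (at s within I)" "contact_form (\<gamma> s) D = 0"
  shows "((\<lambda>s. Pi_proj (\<gamma> s)) has_vector_derivative 2 * \<i> * cnj (fst (\<gamma> s)) * fst D) (at s within I)"
proof -
  have "contact_form (\<gamma> s) (h *\<^sub>R D) = h * contact_form (\<gamma> s) D" for h
    by (simp add: contact_form_def algebra_simps)
  then show ?thesis
    using has_derivative_Pi_comp[OF assms(1)[unfolded has_vector_derivative_def]] assms(2)
    unfolding has_vector_derivative_def by (simp add: scaleR_conv_of_real mult_ac)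
qed

section \<open>Uniqueness and existence of horizontal lifts\<close>

lemma has_vector_derivative_divide_complex:
  fixes u v :: "real \<Rightarrow> complex"
  assumes "(u has_vector_derivative u') (at s within I)" "(v has_vector_derivative v') (at s within I)" "v s \<noteq> 0"
  shows "((\<lambda>s. u s / v s) has_vector_derivative (u' * v s - u s * v') / (v s * v s)) (at s within I)"
  using assms unfolding has_vector_derivative_def
  by (auto intro!: derivative_eq_intros simp: field_simps scaleR_conv_of_real)

text \<open>Equal projections give equal moduli and equal second components, so the curves differ by
  a rotation factor \<open>u\<close>. The derivative of the projection of a horizontal curve is 2 i
  conj(\<gamma>_1) \<gamma>_1', so conj(\<gamma>_1) \<gamma>_1' is the same for both curves and u' =
  0; at \<open>s\<^sub>0\<close> the factor is 1.\<close>

lemma horizontal_lift_unique: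
  assumes \<gamma>: "horizontal_curve (I, \<gamma>)" and \<eta>: "horizontal_curve (I, \<eta>)"
    and Pi: "\<And>s. s \<in> I \<Longrightarrow> Pi_proj (\<gamma> s) = Pi_proj (\<eta> s)" and nz: "\<And>s. s \<in> I \<Longrightarrow> fst (\<eta> s) \<noteq> 0"
    and s0: "s\<^sub>0 \<in> I" "\<gamma> s\<^sub>0 = \<eta> s\<^sub>0" and s: "s \<in> I"
  shows "\<gamma> s = \<eta> s"
proof -
  obtain D where I: "is_interval I" "interior I \<noteq> {}"
    and D: "\<And>s. s \<in> I \<Longrightarrow> (\<gamma> has_vector_derivative D s) (at s within I)"
       "\<And>s. s \<in> I \<Longrightarrow> contact_form (\<gamma> s) (D s) = 0"
    using \<gamma> unfolding horizontal_curve_iff by blast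
  obtain E where E: "\<And>s. s \<in> I \<Longrightarrow> (\<eta> has_vector_derivative E s) (at s within I)"
       "\<And>s. s \<in> I \<Longrightarrow> contact_form (\<eta> s) (E s) = 0"
    using \<eta> unfolding horizontal_curve_iff by blast
  have norm_eq: "fst (\<gamma> s) * cnj (fst (\<gamma> s)) = fst (\<eta> s) * cnj (fst (\<eta> s))" "snd (\<gamma> s) = snd (\<eta> s)"
    if "s \<in> I" for s
    using Pi[OF that] by (simp_all add: Pi_proj_def complex_eq_iff complex_mult_cnj cmod_power2)
  define u where "u s = fst (\<gamma> s) / fst (\<eta> s)" for s
  have u': "(u has_vector_derivative 0) (at s within I)" if s: "s \<in> I" for s
  proof -
    have "((\<lambda>s. Pi_proj (\<gamma> s)) has_vector_derivative 2 * \<i> * cnj (fst (\<eta> s)) * fst (E s)) (at s within I)"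
      by (rule has_vector_derivative_transform[OF s _ has_vector_derivative_Pi_horizontal[OF E[OF s]]])
         (simp add: Pi)
    then have "2 * \<i> * cnj (fst (\<eta> s)) * fst (E s) = 2 * \<i> * cnj (fst (\<gamma> s)) * fst (D s)"
      using vector_derivative_unique_within[OF at_within_interval_neq_bot[OF I s]]
        has_vector_derivative_Pi_horizontal[OF D[OF s]] by blast
    then have eq: "cnj (fst (\<gamma> s)) * fst (D s) = cnj (fst (\<eta> s)) * fst (E s)"
      by simp
    have nz\<gamma>: "fst (\<gamma> s) \<noteq> 0"
      using norm_eq(1)[OF s] nz[OF s] by auto
    have "((\<lambda>s. fst (\<gamma> s)) has_vector_derivative fst (D s)) (at s within I)"
      "((\<lambda>s. fst (\<eta> s)) has_vector_derivative fst (E s)) (at s within I)"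
      using D[OF s] E[OF s] by (auto intro: bounded_linear.has_vector_derivative[OF bounded_linear_fst])
    then have "(u has_vector_derivative
        (fst (D s) * fst (\<eta> s) - fst (\<gamma> s) * fst (E s)) / (fst (\<eta> s) * fst (\<eta> s))) (at s within I)"
      unfolding u_def using nz[OF s] by (rule has_vector_derivative_divide_complex)
    moreover have "fst (D s) * fst (\<eta> s) - fst (\<gamma> s) * fst (E s) = 0"
    proof -
      \<comment> \<open>The conjugate factors make \<open>eq\<close> and the equality of the moduli
        applicable.\<close>
      have "cnj (fst (\<eta> s)) * cnj (fst (\<gamma> s)) * (fst (D s) * fst (\<eta> s) - fst (\<gamma> s) * fst (E s)) = 0"
        using eq norm_eq(1)[OF s] by algebra
      then show ?thesis
        using nz[OF s] nz\<gamma> by simp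
    qed
    ultimately show ?thesis
      by simp
  qed
  have "(u has_derivative (\<lambda>h. 0)) (at x within I)" if "x \<in> I" for x
    using u'[OF that] by (simp add: has_vector_derivative_def)
  then have "u s = u s\<^sub>0"
    by (rule has_derivative_zero_unique[OF is_interval_convex[OF I(1)] _ s s0(1)])
  then have "fst (\<gamma> s) = fst (\<eta> s)"
    using s0 nz[OF s0(1)] nz[OF s] by (simp add: u_def)
  then show ?thesis
    using norm_eq(2)[OF s] by (simp add: prod_eq_iff)
qed

text \<open>\<open>I\<close> may be open or unbounded, so the fundamental theorem is applied on a
  compact [a, b] in \<open>I\<close> that contains \<open>s\<^sub>0\<close> and is a neighbourhood
  of \<open>s\<close> relative to \<open>I\<close>.\<close>

lemma antiderivative_interval:
  fixes \<phi> :: "real \<Rightarrow> real"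
  assumes I: "is_interval I" and \<phi>: "continuous_on I \<phi>" and "s\<^sub>0 \<in> I"
  obtains \<theta> where "\<theta> s\<^sub>0 = 0" "\<And>s. s \<in> I \<Longrightarrow> (\<theta> has_vector_derivative \<phi> s) (at s within I)"
proof -
  \<comment> \<open>The signed integral from \<open>s\<^sub>0\<close> to s: an interval with
    reversed bounds is empty and contributes 0.\<close>
  define \<theta> where "\<theta> s = integral {s\<^sub>0..s} \<phi> - integral {s..s\<^sub>0} \<phi>" for s
  have "(\<theta> has_vector_derivative \<phi> s) (at s within I)" if s: "s \<in> I" for s
  proof -
    obtain a where a: "a \<in> I" "a \<le> s" "a \<le> s\<^sub>0" "a < s \<or> (\<forall>x\<in>I. s \<le> x)"
    proof (cases "\<exists>x\<in>I. x < s")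
      case True
      then obtain x where "x \<in> I" "x < s" by blast
      then show thesis
        using that[of "min x s\<^sub>0"] \<open>s\<^sub>0 \<in> I\<close> by (auto simp: min_def split: if_splits)
    next
      case False
      then show thesis
        using that[of s] s \<open>s\<^sub>0 \<in> I\<close> by (auto simp: not_less)
    qed
    obtain b where b: "b \<in> I" "s \<le> b" "s\<^sub>0 \<le> b" "s < b \<or> (\<forall>x\<in>I. x \<le> s)"
    proof (cases "\<exists>x\<in>I. s < x")
      case True
      then obtain x where "x \<in> I" "s < x" by blast
      then show thesis
        using that[of "max x s\<^sub>0"] \<open>s\<^sub>0 \<in> I\<close> by (auto simp: max_def split: if_splits)
    next
      case False
      then show thesis
        using that[of s] s \<open>s\<^sub>0 \<in> I\<close> by (auto simp: not_less)
    qed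
    have sub: "{a..b} \<subseteq> I"
      using I a(1) b(1) unfolding is_interval_1 by (meson atLeastAtMost_iff subsetI)
    then have cont: "continuous_on {a..b} \<phi>"
      using \<phi> continuous_on_subset by blast
    have int: "\<phi> integrable_on {x..y}" if "a \<le> x" "y \<le> b" for x y
      using that by (intro integrable_continuous_interval continuous_on_subset[OF cont]) auto
    have \<theta>: "\<theta> x = integral {a..x} \<phi> - integral {a..s\<^sub>0} \<phi>" if "x \<in> {a..b}" for x
    proof (cases "s\<^sub>0 \<le> x")
      case True
      then have "\<theta> x = integral {s\<^sub>0..x} \<phi>"
        by (cases "x = s\<^sub>0") (auto simp: \<theta>_def)
      then show ?thesis
        using that a b True int[of a x] Henstock_Kurzweil_Integration.integral_combine[of a "s\<^sub>0" x \<phi>] by auto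
    next
      case False
      then have "\<theta> x = - integral {x..s\<^sub>0} \<phi>"
        by (auto simp: \<theta>_def)
      then show ?thesis
        using that a b False int[of a "s\<^sub>0"] Henstock_Kurzweil_Integration.integral_combine[of a x "s\<^sub>0" \<phi>] by auto
    qed
    have "((\<lambda>x. integral {a..x} \<phi> - integral {a..s\<^sub>0} \<phi>) has_vector_derivative \<phi> s - 0) (at s within {a..b})"
      using a b by (intro has_vector_derivative_diff integral_has_vector_derivative cont) auto
    then have "(\<theta> has_vector_derivative \<phi> s) (at s within {a..b})"
      using a b \<theta> by (intro has_vector_derivative_transform[of s "{a..b}" \<theta>]) auto
    moreover have "at s within {a..b} = at s within I"
    proof (rule at_within_nhd)
      \<comment> \<open>If \<open>a = s\<close>, then \<open>s\<close> is the least point of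
        \<open>I\<close> and any lower bound below \<open>s\<close> will do; likewise above.\<close>
      let ?U = "{(if a < s then a else s - 1)<..<(if s < b then b else s + 1)}"
      show "s \<in> ?U" "open ?U"
        by auto
      show "{a..b} \<inter> ?U - {s} = I \<inter> ?U - {s}"
        using sub a b by (force split: if_splits)
    qed
    ultimately show ?thesis
      by simp
  qed
  moreover have "\<theta> s\<^sub>0 = 0"
    by (simp add: \<theta>_def)
  ultimately show thesis
    using that by blast
qed

text \<open>A curve over \<open>c\<close> has modulus r = sqrt(Im c) and second component Re c, so
  only its argument \<theta> is free. Horizontality reads Re c' = -2 r^2 \<theta>', which is solved
  by integrating \<open>\<phi>\<close>.\<close>

lemma horizontal_lift_exists:
  assumes c: "C1_curve (I, c)" and Im_c: "\<And>s. s \<in> I \<Longrightarrow> Im (c s) > 0"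
    and s0: "s\<^sub>0 \<in> I" "Pi_proj p = c s\<^sub>0"
  obtains \<gamma> where "horizontal_curve (I, \<gamma>)" "\<gamma> s\<^sub>0 = p" "\<And>s. s \<in> I \<Longrightarrow> Pi_proj (\<gamma> s) = c s"
proof -
  obtain C where I: "is_interval I" "interior I \<noteq> {}" and C: "continuous_on I C"
    and c': "\<And>s. s \<in> I \<Longrightarrow> (c has_vector_derivative C s) (at s within I)"
    using c by auto
  have cont_c: "continuous_on I c"
    using c' by (auto simp: continuous_on_eq_continuous_within intro: has_vector_derivative_continuous)
  define \<phi> where "\<phi> s = - Re (C s) / (2 * Im (c s))" for s
  have cont_\<phi>: "continuous_on I \<phi>"
    unfolding \<phi>_def using Im_c by (intro continuous_intros C cont_c) fastforce
  obtain \<theta> where \<theta>: "\<theta> s\<^sub>0 = 0" "\<And>s. s \<in> I \<Longrightarrow> (\<theta> has_vector_derivative \<phi> s) (at s within I)"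
    using antiderivative_interval[OF I(1) cont_\<phi> s0(1)] by blast
  have cont_\<theta>: "continuous_on I \<theta>"
    using \<theta>(2) by (auto simp: continuous_on_eq_continuous_within intro: has_vector_derivative_continuous)
  define r where "r s = sqrt (Im (c s))" for s
  have r: "r s > 0" "r s * r s = Im (c s)" if "s \<in> I" for s
    using Im_c[OF that] by (auto simp: r_def)
  have p: "snd p = Re (c s\<^sub>0)" "cmod (fst p) = r s\<^sub>0"
    using s0(2) real_sqrt_abs[of "cmod (fst p)"] by (auto simp: Pi_proj_def r_def complex_eq_iff)
  \<comment> \<open>Since \<theta> vanishes at \<open>s\<^sub>0\<close>, the unit factor
    \<open>sgn (fst p)\<close> makes the lift pass through \<open>p\<close> there.\<close>
  define a where "a s = of_real (r s) * (cis (\<theta> s) * sgn (fst p))" for s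
  \<comment> \<open>Product rule: (r' + i r \<theta>') times the unit factor, with r' = Im c' / (2
    r).\<close>
  define a' where "a' s = Complex (Im (C s) / (2 * r s)) (r s * \<phi> s) * (cis (\<theta> s) * sgn (fst p))" for s
  have unit: "cnj (cis (\<theta> s) * sgn (fst p)) * (cis (\<theta> s) * sgn (fst p)) = 1" for s
  proof -
    have "cmod (cis (\<theta> s) * sgn (fst p)) = 1"
      using p r(1)[OF s0(1)] by (auto simp: norm_mult norm_sgn)
    then show ?thesis
      using complex_norm_square[of "cis (\<theta> s) * sgn (fst p)"] by (simp add: mult_ac)
  qed
  define \<gamma> where "\<gamma> s = (a s, Re (c s))" for s
  have \<gamma>': "(\<gamma> has_vector_derivative (a' s, Re (C s))) (at s within I)" if s: "s \<in> I" for s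
  proof -
    have c1: "((\<lambda>s. Re (c s)) has_vector_derivative Re (C s)) (at s within I)"
      "((\<lambda>s. Im (c s)) has_vector_derivative Im (C s)) (at s within I)"
      using c'[OF s] by (auto intro: bounded_linear.has_vector_derivative bounded_linear_Re bounded_linear_Im)
    have r': "(r has_real_derivative (Im (C s) / (2 * r s))) (at s within I)"
      using c1(2) Im_c[OF s] unfolding r_def[abs_def] has_real_derivative_iff_has_vector_derivative[symmetric]
      by (rule DERIV_cong[OF DERIV_chain'[OF _ DERIV_real_sqrt]]) (auto simp: field_simps)
    have "((\<lambda>s. cis (\<theta> s)) has_vector_derivative (\<i> * of_real (\<phi> s) * cis (\<theta> s))) (at s within I)"
      unfolding cis_conv_exp has_vector_derivative_def
      by (rule has_derivative_eq_rhs[OF has_derivative_compose[OF has_derivative_mult_right[OF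
            has_derivative_of_real[OF \<theta>(2)[OF s, unfolded has_vector_derivative_def]]]
            DERIV_exp[unfolded has_field_derivative_def]]])
         (simp add: fun_eq_iff scaleR_conv_of_real)
    from has_vector_derivative_mult[OF has_vector_derivative_of_real[OF r']
        has_vector_derivative_mult_left[OF this, of "sgn (fst p)"]]
    have "(a has_vector_derivative a' s) (at s within I)"
      unfolding a_def[abs_def] a'_def Complex_eq
      by (rule has_vector_derivative_eq_rhs) (simp add: algebra_simps)
    then show ?thesis
      unfolding \<gamma>_def[abs_def] using c1(1) by (intro has_vector_derivative_Pair)
  qed
  have "cnj (a s) * a' s = of_real (r s) * Complex (Im (C s) / (2 * r s)) (r s * \<phi> s) *
      (cnj (cis (\<theta> s) * sgn (fst p)) * (cis (\<theta> s) * sgn (fst p)))" for s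
    by (simp add: a_def a'_def mult_ac)
  then have aa': "cnj (a s) * a' s = of_real (r s) * Complex (Im (C s) / (2 * r s)) (r s * \<phi> s)" for s
    by (simp only: unit mult_1_right)
  have "contact_form (\<gamma> s) (a' s, Re (C s)) = 0" if s: "s \<in> I" for s
  proof -
    have "Im (cnj (a s) * a' s) = (r s * r s) * \<phi> s"
      unfolding aa' by simp
    then show ?thesis
      using r[OF s] Im_c[OF s] by (simp add: contact_form_def \<gamma>_def \<phi>_def del: times_complex.sel)
  qed
  moreover have "continuous_on I (\<lambda>s. (a' s, Re (C s)))"
    unfolding a'_def Complex_eq r_def using r unfolding r_def
    by (intro continuous_intros C cont_c cont_\<theta> cont_\<phi>) (auto simp: less_le)
  ultimately have "horizontal_curve (I, \<gamma>)"
    unfolding horizontal_curve_iff using I \<gamma>' by blast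
  moreover have "\<gamma> s\<^sub>0 = p"
    using \<theta>(1) p(1) r(1)[OF s0(1)]
    by (simp add: \<gamma>_def a_def prod_eq_iff sgn_div_norm scaleR_conv_of_real p(2))
  moreover have "Pi_proj (\<gamma> s) = c s" if "s \<in> I" for s
  proof -
    have "fst p \<noteq> 0"
      using p(2) r(1)[OF s0(1)] by auto
    then have "cmod (a s) = r s"
      using r(1)[OF that] by (simp add: a_def norm_mult norm_sgn)
    then show ?thesis
      using r(2)[OF that] by (simp add: Pi_proj_def \<gamma>_def complex_eq_iff power2_eq_square)
  qed
  ultimately show thesis
    using that by blast
qed

section \<open>Admissible densities for families of horizontal curves\<close>

lemma adm_heis_iff:
  "\<rho> \<in> adm_heis \<Omega> \<Gamma> \<longleftrightarrow> \<rho> \<in> borel_measurable (restrict_space borel \<Omega>) \<and>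
     (\<forall>I \<gamma>. (I, \<gamma>) \<in> \<Gamma> \<longrightarrow> 1 \<le> (\<integral>\<^sup>+s\<in>I. (\<rho> (\<gamma> s) *
        ennreal (cmod (vector_derivative (fst \<circ> \<gamma>) (at s within I)))) \<partial>lborel))"
  unfolding adm_heis_def mem_Collect_eq Ball_def split_paired_All prod.case ..

text \<open>Curves carry irrelevant values outside their intervals, so families are compared by
  agreement on \<open>I\<close>. Line integrals, with derivatives taken within \<open>I\<close>,
  cannot tell such curves apart.\<close>

lemma adm_heis_antimono:
  assumes "\<And>I \<gamma>. (I, \<gamma>) \<in> \<Gamma> \<Longrightarrow> \<exists>\<eta>. (I, \<eta>) \<in> \<Gamma>' \<and> (\<forall>s\<in>I. \<eta> s = \<gamma> s)"
  shows "adm_heis \<Omega> \<Gamma>' \<subseteq> adm_heis \<Omega> \<Gamma>"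
proof
  fix \<rho> assume \<rho>: "\<rho> \<in> adm_heis \<Omega> \<Gamma>'"
  have "1 \<le> (\<integral>\<^sup>+s\<in>I. (\<rho> (\<gamma> s) * ennreal (cmod (vector_derivative (fst \<circ> \<gamma>) (at s within I)))) \<partial>lborel)"
    if \<gamma>: "(I, \<gamma>) \<in> \<Gamma>" for I \<gamma>
  proof -
    obtain \<eta> where \<eta>: "(I, \<eta>) \<in> \<Gamma>'" "\<forall>s\<in>I. \<eta> s = \<gamma> s"
      using assms[OF \<gamma>] by blast
    have "vector_derivative (fst \<circ> \<eta>) (at s within I) = vector_derivative (fst \<circ> \<gamma>) (at s within I)"
      if "s \<in> I" for s
      using \<eta>(2) that by (intro vector_derivative_cong_eq) auto
    then have "(\<integral>\<^sup>+s\<in>I. (\<rho> (\<eta> s) * ennreal (cmod (vector_derivative (fst \<circ> \<eta>) (at s within I)))) \<partial>lborel)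
       = (\<integral>\<^sup>+s\<in>I. (\<rho> (\<gamma> s) * ennreal (cmod (vector_derivative (fst \<circ> \<gamma>) (at s within I)))) \<partial>lborel)"
      using \<eta>(2) by (intro nn_integral_cong) (auto simp: indicator_def)
    moreover have "1 \<le> (\<integral>\<^sup>+s\<in>I. (\<rho> (\<eta> s) * ennreal (cmod (vector_derivative (fst \<circ> \<eta>) (at s within I)))) \<partial>lborel)"
      by (rule \<rho>[unfolded adm_heis_iff, THEN conjunct2, rule_format, OF \<eta>(1)])
    ultimately show ?thesis
      by simp
  qed
  then show "\<rho> \<in> adm_heis \<Omega> \<Gamma>"
    using \<rho>[unfolded adm_heis_iff, THEN conjunct1] unfolding adm_heis_iff by iprover
qed

section \<open>Quasiconformal maps and lifted families\<close>

text \<open>The inverse of \<open>Psi\<close> sends p to the pair of \<open>sgn (fst p)\<close> and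
  \<open>Pi_proj p\<close>. As a preimage under a continuous map, the lifted domain is seen to be
  open.\<close>

lemma lifted_domain_eq:
  assumes "\<Omega> \<subseteq> upper_half_plane"
  shows "lifted_domain \<Omega> = Pi_proj -` \<Omega>"
proof (intro equalityI subsetI)
  fix p assume "p \<in> lifted_domain \<Omega>"
  then obtain u w where p: "p = Psi (u, w)" "cmod u = 1" "w \<in> \<Omega>"
    by (auto simp: lifted_domain_def)
  then have "Im w > 0"
    using assms by (auto simp: upper_half_plane_def)
  then have "Pi_proj p = w"
    using p by (simp add: Psi_def Pi_proj_def norm_mult complex_eq_iff)
  then show "p \<in> Pi_proj -` \<Omega>"
    using p by simp
next
  fix p assume p: "p \<in> Pi_proj -` \<Omega>"
  then have "Im (Pi_proj p) > 0"
    using assms by (auto simp: upper_half_plane_def)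
  then have nz: "fst p \<noteq> 0"
    by (auto simp: Pi_proj_def)
  then have "p = Psi (sgn (fst p), Pi_proj p)"
    by (simp add: Psi_def Pi_proj_def prod_eq_iff sgn_div_norm scaleR_conv_of_real)
  moreover have "sgn (fst p) \<in> sphere 0 1"
    using nz by (simp add: norm_sgn)
  ultimately show "p \<in> lifted_domain \<Omega>"
    using p unfolding lifted_domain_def by blast
qed

lemma fst_lifted_domain:
  assumes "\<Omega> \<subseteq> upper_half_plane" "p \<in> lifted_domain \<Omega>"
  shows "fst p \<noteq> 0"
  using assms by (auto simp: lifted_domain_eq Pi_proj_def upper_half_plane_def)

lemma continuous_on_Pi_proj: "continuous_on S Pi_proj"
  unfolding Pi_proj_def by (intro continuous_intros)

lemma open_lifted_domain:
  assumes "open \<Omega>" "\<Omega> \<subseteq> upper_half_plane"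
  shows "open (lifted_domain \<Omega>)"
  using assms continuous_on_Pi_proj by (auto simp: lifted_domain_eq intro: open_vimage)

lemma measurable_restrict_borel_continuous_on:
  assumes "continuous_on A u" "u ` A \<subseteq> B"
  shows "u \<in> restrict_space borel A \<rightarrow>\<^sub>M restrict_space borel B"
  using assms by (auto simp: measurable_restrict_space2_iff space_restrict_space
      intro!: borel_measurable_continuous_on_restrict)

text \<open>The essential supremum bounds |\<mu>| almost everywhere. The pointwise form serves
  twice: for contactness and for |Zbar f1| <= |Z f1|.\<close>

lemma orientation_preserving_heis_AE:
  assumes "orientation_preserving_heis A f" "open A"
  shows "AE p in lebesgue_on A. \<exists>\<mu>. cmod \<mu> < 1 \<and>
      Zbar_op (\<lambda>p. fst (f p)) p = \<mu> * Z_op (\<lambda>p. fst (f p)) p \<and>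
      Zbar_op (\<lambda>p. Pi_proj (f p)) p = \<mu> * Z_op (\<lambda>p. Pi_proj (f p)) p"
proof -
  obtain \<mu> where \<mu>: "beltrami_coefficient A \<mu>"
    and eq: "AE p in lebesgue_on A. Zbar_op (\<lambda>p. fst (f p)) p = \<mu> p * Z_op (\<lambda>p. fst (f p)) p \<and>
      Zbar_op (\<lambda>p. Pi_proj (f p)) p = \<mu> p * Z_op (\<lambda>p. Pi_proj (f p)) p"
    using assms(1) unfolding orientation_preserving_heis_def Pi_proj_def Let_def by blast
  have "AE p in lebesgue_on A. ereal (cmod (\<mu> p)) \<le> esssup (lebesgue_on A) (\<lambda>p. ereal (cmod (\<mu> p)))"
    by (rule esssup_AE)
  moreover have "esssup (lebesgue_on A) (\<lambda>p. ereal (cmod (\<mu> p))) < 1"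
    using \<mu> by (simp add: beltrami_coefficient_def)
  ultimately have "AE p in lebesgue_on A. cmod (\<mu> p) < 1"
    by (auto elim!: eventually_mono dest: le_less_trans simp: one_ereal_def)
  with eq show ?thesis
    by eventually_elim blast
qed

text \<open>\<open>beltrami_imp_contact\<close> gives the contact equations almost everywhere; their
  left sides are continuous, so they hold at every point.\<close>

lemma contact_on_orientation_preserving:
  fixes f' :: "heis \<Rightarrow> heis \<Rightarrow>\<^sub>L heis"
  assumes "open A" "orientation_preserving_heis A f"
    and f: "\<And>p. p \<in> A \<Longrightarrow> (f has_derivative f' p) (at p)" and f': "continuous_on A f'"
  shows "contact_on A f (\<lambda>p. blinfun_apply (f' p))"
proof -
  have ae: "AE p in lebesgue_on A. contact_form (f p) (f' p (X_vec p)) = 0 \<and> contact_form (f p) (f' p (Y_vec p)) = 0"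
    using orientation_preserving_heis_AE[OF assms(2,1)] AE_space
  proof eventually_elim
    case (elim p)
    then have "p \<in> A"
      by (simp add: space_restrict_space)
    with elim(1) show ?case
      using beltrami_imp_contact[OF f[OF \<open>p \<in> A\<close>]] by blast
  qed
  have f_cont: "continuous_on A f"
    using f by (meson continuous_at_imp_continuous_on has_derivative_continuous)
  have cont: "continuous_on A (\<lambda>p. contact_form (f p) (f' p (V p)))" if "continuous_on A V" for V
    unfolding contact_form_def by (intro continuous_intros f_cont f' that)
  have "continuous_on A X_vec" "continuous_on A Y_vec"
    unfolding X_vec_def Y_vec_def by (intro continuous_intros)+
  note 0 = continuous_on_AE_zero[OF \<open>open A\<close> cont[OF this(1)], of 0]
    continuous_on_AE_zero[OF \<open>open A\<close> cont[OF this(2)], of 0]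
  from ae have "AE p in lebesgue_on A. contact_form (f p) (f' p (X_vec p)) = 0"
    "AE p in lebesgue_on A. contact_form (f p) (f' p (Y_vec p)) = 0"
    by (auto elim: eventually_mono)
  from 0(1)[OF this(1)] 0(2)[OF this(2)] show ?thesis
    unfolding contact_on_def by blast
qed

text \<open>Up to values outside the parameter intervals the two families consist of the same
  curves, so they have the same admissible densities.\<close>

lemma modulus_heis_image_lifted_family:
  fixes f' :: "heis \<Rightarrow> heis \<Rightarrow>\<^sub>L heis"
  assumes \<Omega>: "\<Omega> \<subseteq> upper_half_plane" and \<Omega>': "\<Omega>' \<subseteq> upper_half_plane"
    and fA: "f ` lifted_domain \<Omega> = lifted_domain \<Omega>'" and g: "inj_on g \<Omega>" "g ` \<Omega> \<subseteq> \<Omega>'"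
    and fg: "\<And>p. p \<in> lifted_domain \<Omega> \<Longrightarrow> Pi_proj (f p) = g (Pi_proj p)"
    and \<Gamma>: "curve_family_in \<Omega> \<Gamma>"
    and f: "\<And>p. p \<in> lifted_domain \<Omega> \<Longrightarrow> (f has_derivative f' p) (at p)"
    and f': "continuous_on (lifted_domain \<Omega>) f'"
    and contact: "contact_on (lifted_domain \<Omega>) f (\<lambda>p. blinfun_apply (f' p))"
  shows "modulus_heis B (image_family f (lifted_family \<Gamma>)) =
     modulus_heis B (lifted_family (image_family g \<Gamma>))"
proof -
  have c: "C1_curve (I, c)" "\<And>s. s \<in> I \<Longrightarrow> c s \<in> \<Omega>" if "(I, c) \<in> \<Gamma>" for I c
    using bspec[OF \<Gamma>[unfolded curve_family_in_def] that] by auto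
  have hor: "horizontal_curve (I, f \<circ> \<gamma>)"
    if "horizontal_curve (I, \<gamma>)" "\<And>s. s \<in> I \<Longrightarrow> Pi_proj (\<gamma> s) \<in> \<Omega>" for I \<gamma>
    using that by (intro horizontal_curve_image[OF _ _ f f' contact]) (auto simp: lifted_domain_eq[OF \<Omega>])
  have 1: "(I, \<delta>) \<in> lifted_family (image_family g \<Gamma>)"
    if I\<delta>: "(I, \<delta>) \<in> image_family f (lifted_family \<Gamma>)" for I \<delta>
  proof -
    obtain \<gamma> c where \<delta>: "\<delta> = f \<circ> \<gamma>" and \<gamma>: "horizontal_curve (I, \<gamma>)"
      and Ic: "(I, c) \<in> \<Gamma>" and Pi: "\<And>s. s \<in> I \<Longrightarrow> Pi_proj (\<gamma> s) = c s"
      using I\<delta> by (auto simp: image_family_def lifted_family_def simp del: horizontal_curve.simps)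
    have "horizontal_curve (I, \<delta>)"
      unfolding \<delta> using c(2)[OF Ic] Pi by (intro hor \<gamma>) simp
    moreover have "Pi_proj (\<delta> s) = (g \<circ> c) s" if "s \<in> I" for s
      using fg[of "\<gamma> s"] c(2)[OF Ic that] Pi[OF that] by (simp add: \<delta> lifted_domain_eq[OF \<Omega>])
    moreover have "(I, g \<circ> c) \<in> image_family g \<Gamma>"
      using Ic by (auto simp: image_family_def)
    ultimately show ?thesis
      unfolding lifted_family_def by blast
  qed
  have 2: "\<exists>\<delta>. (I, \<delta>) \<in> image_family f (lifted_family \<Gamma>) \<and> (\<forall>s\<in>I. \<delta> s = \<eta> s)"
    if I\<eta>: "(I, \<eta>) \<in> lifted_family (image_family g \<Gamma>)" for I \<eta>
  proof -
    obtain c where \<eta>: "horizontal_curve (I, \<eta>)" and Ic: "(I, c) \<in> \<Gamma>"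
      and Pi: "\<And>s. s \<in> I \<Longrightarrow> Pi_proj (\<eta> s) = g (c s)"
      using I\<eta> by (auto simp: image_family_def lifted_family_def simp del: horizontal_curve.simps)
    have \<eta>B: "\<eta> s \<in> lifted_domain \<Omega>'" if "s \<in> I" for s
      using Pi[OF that] c(2)[OF Ic that] g(2) by (auto simp: lifted_domain_eq[OF \<Omega>'])
    obtain s\<^sub>0 where s0: "s\<^sub>0 \<in> I"
      using \<eta> interior_subset[of I] unfolding horizontal_curve_iff by blast
    \<comment> \<open>Surjectivity of \<open>f\<close> provides \<open>p\<close>, and injectivity of
      \<open>g\<close> places it over \<open>c s\<^sub>0\<close>. The lift of \<open>c\<close>
      through \<open>p\<close> is then mapped to a lift that meets \<open>\<eta>\<close> at
      \<open>s\<^sub>0\<close>.\<close>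
    obtain p where p: "p \<in> lifted_domain \<Omega>" "f p = \<eta> s\<^sub>0"
      using \<eta>B[OF s0] fA by (metis imageE)
    have "g (Pi_proj p) = g (c s\<^sub>0)"
      using fg[OF p(1)] p(2) Pi[OF s0] by simp
    then have "Pi_proj p = c s\<^sub>0"
      using g(1) p(1) c(2)[OF Ic s0] by (auto simp: lifted_domain_eq[OF \<Omega>] inj_on_def)
    moreover have "Im (c s) > 0" if "s \<in> I" for s
      using c(2)[OF Ic that] \<Omega> by (auto simp: upper_half_plane_def)
    ultimately obtain \<gamma> where \<gamma>: "horizontal_curve (I, \<gamma>)" "\<gamma> s\<^sub>0 = p"
        and Pi\<gamma>: "\<And>s. s \<in> I \<Longrightarrow> Pi_proj (\<gamma> s) = c s"
      using horizontal_lift_exists[OF c(1)[OF Ic] _ s0] by blast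
    have "(f \<circ> \<gamma>) s = \<eta> s" if "s \<in> I" for s
    proof (rule horizontal_lift_unique[OF _ \<eta> _ _ s0 _ that])
      show "horizontal_curve (I, f \<circ> \<gamma>)"
        using c(2)[OF Ic] Pi\<gamma> by (intro hor \<gamma>) simp
      show "Pi_proj ((f \<circ> \<gamma>) s) = Pi_proj (\<eta> s)" if "s \<in> I" for s
        using fg[of "\<gamma> s"] c(2)[OF Ic that] Pi\<gamma>[OF that] Pi[OF that] by (simp add: lifted_domain_eq[OF \<Omega>])
      show "fst (\<eta> s) \<noteq> 0" if "s \<in> I" for s
        using fst_lifted_domain[OF \<Omega>' \<eta>B[OF that]] .
      show "(f \<circ> \<gamma>) s\<^sub>0 = \<eta> s\<^sub>0"
        using p(2) \<gamma>(2) by simp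
    qed
    moreover have "(I, f \<circ> \<gamma>) \<in> image_family f (lifted_family \<Gamma>)"
      using \<gamma>(1) Ic Pi\<gamma> unfolding image_family_def lifted_family_def by blast
    ultimately show ?thesis
      by blast
  qed
  have "adm_heis B (image_family f (lifted_family \<Gamma>)) = adm_heis B (lifted_family (image_family g \<Gamma>))"
  proof (rule antisym)
    show "adm_heis B (image_family f (lifted_family \<Gamma>)) \<subseteq> adm_heis B (lifted_family (image_family g \<Gamma>))"
      by (rule adm_heis_antimono) (rule 2)
    show "adm_heis B (lifted_family (image_family g \<Gamma>)) \<subseteq> adm_heis B (image_family f (lifted_family \<Gamma>))"
      by (rule adm_heis_antimono) (use 1 in blast)
  qed
  then show ?thesis
    by (simp add: modulus_heis_def)
qed

section \<open>Measurability of push-forward and pull-back densities\<close>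

lemma measurable_push_forward:
  assumes "homeomorphism \<Omega> \<Omega>' g k" "C2_on \<Omega> g"
    and \<rho>: "\<rho> \<in> borel_measurable (restrict_space borel \<Omega>)"
  shows "push_forward \<Omega> g \<rho> \<in> borel_measurable (restrict_space borel \<Omega>')"
proof -
  obtain g' :: "complex \<Rightarrow> complex \<Rightarrow>\<^sub>L complex" and g'' :: "complex \<Rightarrow> complex \<Rightarrow>\<^sub>L complex \<Rightarrow>\<^sub>L complex"
    where g: "\<And>w. w \<in> \<Omega> \<Longrightarrow> (g has_derivative g' w) (at w)"
      and g': "\<And>w. w \<in> \<Omega> \<Longrightarrow> (g' has_derivative g'' w) (at w)"
    using assms(2) unfolding C2_on_def by blast
  have "continuous_on \<Omega> g'"
    using g' by (meson continuous_at_imp_continuous_on has_derivative_continuous)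
  then have "continuous_on \<Omega> (\<lambda>w. cmod ((g' w 1 - \<i> * g' w \<i>) / 2) - cmod ((g' w 1 + \<i> * g' w \<i>) / 2))"
    by (intro continuous_intros) auto
  moreover have "cmod (d_w g w) - cmod (d_wbar g w) =
      cmod ((g' w 1 - \<i> * g' w \<i>) / 2) - cmod ((g' w 1 + \<i> * g' w \<i>) / 2)" if "w \<in> \<Omega>" for w
    using frechet_derivative_at[OF g[OF that]] by (simp add: d_w_def d_wbar_def Let_def)
  ultimately have "continuous_on \<Omega> (\<lambda>w. cmod (d_w g w) - cmod (d_wbar g w))"
    by (simp cong: continuous_on_cong)
  then have [measurable]: "(\<lambda>w. cmod (d_w g w) - cmod (d_wbar g w)) \<in> borel_measurable (restrict_space borel \<Omega>)"
    by (rule borel_measurable_continuous_on_restrict)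
  have [measurable]: "(\<lambda>w. \<rho> w / ennreal (cmod (d_w g w) - cmod (d_wbar g w))) \<in> borel_measurable (restrict_space borel \<Omega>)"
    using \<rho> by measurable
  have k [measurable]: "k \<in> restrict_space borel \<Omega>' \<rightarrow>\<^sub>M restrict_space borel \<Omega>"
    using assms(1) by (intro measurable_restrict_borel_continuous_on) (auto simp: homeomorphism_def)
  have "(\<lambda>w. (\<lambda>w. \<rho> w / ennreal (cmod (d_w g w) - cmod (d_wbar g w))) (k w)) \<in> borel_measurable (restrict_space borel \<Omega>')"
    by (rule measurable_compose[OF k]) measurable
  \<comment> \<open>On \<open>\<Omega>'\<close> this choice of inverse is the continuous map
    \<open>k\<close>, for which measurability has just been shown.\<close>
  moreover have "the_inv_into \<Omega> g w = k w" if "w \<in> \<Omega>'" for w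
    using assms(1) that by (intro the_inv_into_f_eq) (auto simp: homeomorphism_def intro: inj_on_inverseI[of _ k])
  ultimately show ?thesis
    by (subst measurable_cong[where g = "\<lambda>w. \<rho> (k w) / ennreal (cmod (d_w g (k w)) - cmod (d_wbar g (k w)))"])
       (auto simp: push_forward_def space_restrict_space)
qed

lemma measurable_Pi_pull_back:
  assumes "\<Omega> \<subseteq> upper_half_plane" "\<rho> \<in> borel_measurable (restrict_space borel \<Omega>)"
  shows "Pi_pull_back \<rho> \<in> borel_measurable (restrict_space borel (lifted_domain \<Omega>))"
proof -
  have "Pi_proj \<in> restrict_space borel (lifted_domain \<Omega>) \<rightarrow>\<^sub>M restrict_space borel \<Omega>"
    using assms(1) by (intro measurable_restrict_borel_continuous_on continuous_on_Pi_proj) (auto simp: lifted_domain_eq)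
  from measurable_compose[OF this assms(2)]
  have [measurable]: "(\<lambda>p. \<rho> (Pi_proj p)) \<in> borel_measurable (restrict_space borel (lifted_domain \<Omega>))" .
  have [measurable]: "(\<lambda>p. 2 * cmod (fst p)) \<in> borel_measurable (restrict_space borel (lifted_domain \<Omega>))"
    by (intro borel_measurable_continuous_on_restrict continuous_intros)
  show ?thesis
    unfolding Pi_pull_back_def[abs_def] by measurable
qed

text \<open>The planar determinant \<open>?l\<close> enters the Jacobian twice: as horizontal block,
  and as vertical entry by \<open>contact_form_vertical\<close>. Expanding Z and Zbar in X and Y
  identifies it with the difference of the squared moduli.\<close>

lemma heis_jacobian_quasiconformal:
  fixes f' :: "heis \<Rightarrow> heis \<Rightarrow>\<^sub>L heis" and f'' :: "heis \<Rightarrow> heis \<Rightarrow>\<^sub>L heis"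
  assumes A: "open A" "p \<in> A"
    and f: "\<And>q. q \<in> A \<Longrightarrow> (f has_derivative f' q) (at q)"
    and f'': "(f' has_derivative f'') (at p)"
    and contact: "contact_on A f (\<lambda>q. blinfun_apply (f' q))"
  shows "heis_jacobian (f' p) =
     ((cmod (Z_op (\<lambda>q. fst (f q)) p))\<^sup>2 - (cmod (Zbar_op (\<lambda>q. fst (f q)) p))\<^sup>2)\<^sup>2"
proof -
  let ?l = "Im (cnj (fst (f' p (X_vec p))) * fst (f' p (Y_vec p)))"
  have "heis_jacobian (f' p) = ?l * ?l"
    using contact A(2) contact_form_vertical[OF A f f'' contact]
      heis_jacobian_contact[OF bounded_linear.linear[OF blinfun.bounded_linear_right], of "f p" "f' p" p]
    by (simp only: contact_on_def)
  moreover have "(cmod (Z_op (\<lambda>q. fst (f q)) p))\<^sup>2 - (cmod (Zbar_op (\<lambda>q. fst (f q)) p))\<^sup>2 = ?l"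
  proof -
    have "(cmod ((u - \<i> * v) / 2))\<^sup>2 - (cmod ((u + \<i> * v) / 2))\<^sup>2 = Im (cnj u * v)" for u v
      unfolding cmod_power2 by (simp add: power2_eq_square field_simps)
    then show ?thesis
      unfolding Z_op_fst[OF f[OF A(2)]] Zbar_op_fst[OF f[OF A(2)]] .
  qed
  ultimately show ?thesis
    by (simp add: power2_eq_square)
qed

text \<open>Meant for a = |Z f1|, b = |Zbar f1|, \<open>z\<^sub>1\<close> = |z|,
  \<open>z\<^sub>2\<close> = |f1| and m = |d_w g| - |d_wbar g|. By \<open>eq\<close> the quotient of
  \<open>z\<^sub>2\<close> by m is that of \<open>z\<^sub>1\<close> by a - b; its fourth power times
  (a - b)^2 (a + b)^2 leaves the squared distortion.\<close>

lemma density_transformation: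
  fixes a b m z\<^sub>1 z\<^sub>2 :: real and r :: ennreal
  assumes "0 \<le> b" "b \<le> a" "0 \<le> z\<^sub>1" "0 < z\<^sub>2" and eq: "z\<^sub>2 * (a - b) = z\<^sub>1 * m"
  shows "(ennreal (2 * z\<^sub>2) * (r / ennreal m)) ^ 4 * ennreal ((a\<^sup>2 - b\<^sup>2)\<^sup>2) =
     (ennreal (2 * z\<^sub>1) * r) ^ 4 * (ennreal ((a + b) / (a - b)))\<^sup>2"
proof (cases "a = b")
  case False
  then have ab: "a - b > 0"
    using assms by simp
  then have pos: "z\<^sub>1 > 0" "m > 0"
    using eq assms by (smt (verit) mult_pos_pos mult_nonneg_nonpos zero_less_mult_iff)+
  have m: "r / ennreal m = r * ennreal (1 / m)"
    using pos by (simp add: divide_ennreal_def inverse_ennreal inverse_eq_divide)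
  have "(2 * z\<^sub>2 * (1 / m)) ^ 4 * (a\<^sup>2 - b\<^sup>2)\<^sup>2 = (2 * z\<^sub>1) ^ 4 * ((a + b) / (a - b))\<^sup>2"
  proof -
    define d e where "d = a - b" and "e = a + b"
    have "2 * z\<^sub>2 * (1 / m) = 2 * z\<^sub>1 / d"
      using eq pos ab unfolding d_def[symmetric] by (simp add: field_simps)
    moreover have "a\<^sup>2 - b\<^sup>2 = d * e"
      by (simp add: d_def e_def power2_eq_square algebra_simps)
    moreover have "d \<noteq> 0"
      using ab by (simp add: d_def)
    ultimately show ?thesis
      unfolding d_def[symmetric] e_def[symmetric]
      by (simp add: power_divide power_mult_distrib) (simp add: field_simps power4_eq_xxxx power2_eq_square)
  qed
  moreover have "ennreal ((2 * z\<^sub>2 * (1 / m)) ^ 4 * (a\<^sup>2 - b\<^sup>2)\<^sup>2) =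
      ennreal (2 * z\<^sub>2) ^ 4 * ennreal (1 / m) ^ 4 * ennreal ((a\<^sup>2 - b\<^sup>2)\<^sup>2)"
    using pos assms by (subst ennreal_mult) (simp_all add: ennreal_power power_mult_distrib ennreal_mult
        del: times_divide_eq_right mult_1_right)
  moreover have "ennreal ((2 * z\<^sub>1) ^ 4 * ((a + b) / (a - b))\<^sup>2) =
      ennreal (2 * z\<^sub>1) ^ 4 * (ennreal ((a + b) / (a - b)))\<^sup>2"
    using pos assms ab by (subst ennreal_mult) (simp_all add: ennreal_power)
  ultimately have "r ^ 4 * (ennreal (2 * z\<^sub>2) ^ 4 * ennreal (1 / m) ^ 4 * ennreal ((a\<^sup>2 - b\<^sup>2)\<^sup>2)) =
      r ^ 4 * (ennreal (2 * z\<^sub>1) ^ 4 * (ennreal ((a + b) / (a - b)))\<^sup>2)"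
    by simp
  then show ?thesis
    unfolding m power_mult_distrib by (simp only: mult_ac)
\<comment> \<open>For a = b the right side is 0 because real division by zero gives 0. On the left
  the Jacobian factor is 0, and in \<open>ennreal\<close> it annihilates even an infinite
  density.\<close>
qed simp

section \<open>Transporting the integral of the third assumption by f\<close>

theorem corollary1p0p9:
  fixes \<Omega> \<Omega>' :: "complex set"
    and g :: "complex \<Rightarrow> complex" and f :: "heis \<Rightarrow> heis"
    and \<Gamma> :: "complex curve set" and \<rho>\<^sub>0 :: "complex \<Rightarrow> ennreal"
  assumes "open \<Omega>" "connected \<Omega>" "\<Omega> \<noteq> {}" "\<Omega> \<subseteq> upper_half_plane"
    and "open \<Omega>'" "connected \<Omega>'" "\<Omega>' \<noteq> {}" "\<Omega>' \<subseteq> upper_half_plane"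
    and "quasiconformal_plane \<Omega> \<Omega>' g"
    and "quasiconformal_heis (lifted_domain \<Omega>) (lifted_domain \<Omega>') f"
    and "\<forall>p\<in>lifted_domain \<Omega>. Pi_proj (f p) = g (Pi_proj p)"
    and "curve_family_in \<Omega> \<Gamma>"
    and "extremal_density_plane \<Omega> \<Gamma> \<rho>\<^sub>0"
    and "modulus_heis (lifted_domain \<Omega>) (lifted_family \<Gamma>) =
           (\<integral>\<^sup>+p\<in>lifted_domain \<Omega>. (Pi_pull_back \<rho>\<^sub>0 p)^4 \<partial>lborel)"
    and "modulus_plane \<Omega>' (image_family g \<Gamma>) =
           (\<integral>\<^sup>+w\<in>\<Omega>. ((\<rho>\<^sub>0 w)^2 * ennreal (K_plane g w)) \<partial>lborel)"
    and "modulus_heis (lifted_domain \<Omega>') (lifted_family (image_family g \<Gamma>)) =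
           (\<integral>\<^sup>+p\<in>lifted_domain \<Omega>'. (Pi_pull_back (push_forward \<Omega> g \<rho>\<^sub>0) p)^4 \<partial>lborel)"
  shows "modulus_heis (lifted_domain \<Omega>') (image_family f (lifted_family \<Gamma>)) =
           (\<integral>\<^sup>+p\<in>lifted_domain \<Omega>. ((Pi_pull_back \<rho>\<^sub>0 p)^4 * (ennreal (K_heis f p))^2) \<partial>lborel)"
proof -
  note \<Omega> = assms(1,4) and \<Omega>' = assms(5,8)
  let ?A = "lifted_domain \<Omega>" and ?B = "lifted_domain \<Omega>'"
  let ?Z = "\<lambda>p. cmod (Z_op (\<lambda>q. fst (f q)) p)" and ?Zb = "\<lambda>p. cmod (Zbar_op (\<lambda>q. fst (f q)) p)"
  have openA: "open ?A" and openB: "open ?B"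
    using open_lifted_domain \<Omega> \<Omega>' by auto
  obtain k where k: "homeomorphism \<Omega> \<Omega>' g k" and g2: "C2_on \<Omega> g"
    using assms(9) by (auto simp: quasiconformal_plane_def)
  then have g_inj: "inj_on g \<Omega>" and g_img: "g ` \<Omega> = \<Omega>'"
    by (auto simp: homeomorphism_def intro: inj_on_inverseI[of _ k])
  obtain h where h: "homeomorphism ?A ?B f h" and f2: "C2_on ?A f" and orient: "orientation_preserving_heis ?A f"
    using assms(10) by (auto simp: quasiconformal_heis_def)
  obtain f' :: "heis \<Rightarrow> heis \<Rightarrow>\<^sub>L heis" and f'' :: "heis \<Rightarrow> heis \<Rightarrow>\<^sub>L heis \<Rightarrow>\<^sub>L heis"
    where f: "\<And>p. p \<in> ?A \<Longrightarrow> (f has_derivative f' p) (at p)"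
      and f'': "\<And>p. p \<in> ?A \<Longrightarrow> (f' has_derivative f'' p) (at p)"
    using f2 unfolding C2_on_def by blast
  have f'_cont: "continuous_on ?A f'"
    using f'' by (meson continuous_at_imp_continuous_on has_derivative_continuous)
  have contact: "contact_on ?A f (\<lambda>p. blinfun_apply (f' p))"
    by (rule contact_on_orientation_preserving[OF openA orient f f'_cont])
  have fg: "Pi_proj (f p) = g (Pi_proj p)" if "p \<in> ?A" for p
    using assms(11) that by blast
  have fA: "f ` ?A = ?B"
    using h by (simp add: homeomorphism_def)
  have \<rho>: "\<rho>\<^sub>0 \<in> borel_measurable (restrict_space borel \<Omega>)"
    using assms(13) by (simp add: extremal_density_plane_def adm_plane_def)
  have J: "(\<lambda>p. heis_jacobian (f' p)) \<in> borel_measurable (restrict_space borel ?A)"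
    \<comment> \<open>The Jacobian is a polynomial in components of \<open>f' p\<close> at three
      fixed vectors, hence continuous in p.\<close>
    unfolding heis_jacobian_eq
    by (intro borel_measurable_continuous_on_restrict continuous_intros f'_cont)
  let ?F = "\<lambda>p. (Pi_pull_back (push_forward \<Omega> g \<rho>\<^sub>0) p) ^ 4"
  have F: "?F \<in> borel_measurable (restrict_space borel ?B)"
    using measurable_Pi_pull_back[OF \<Omega>'(2) measurable_push_forward[OF k g2 \<rho>]] by measurable
  \<comment> \<open>The bound \<open>le\<close> is available only almost everywhere, so it is a
    premise here and is supplied under the integral.\<close>
  have pointwise: "?F (f p) * ennreal \<bar>heis_jacobian (f' p)\<bar> = (Pi_pull_back \<rho>\<^sub>0 p)^4 * (ennreal (K_heis f p))^2"
    if p: "p \<in> ?A" and le: "?Zb p \<le> ?Z p" for p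
  proof -
    let ?w = "Pi_proj p"
    have w: "?w \<in> \<Omega>"
      using p by (simp add: lifted_domain_eq[OF \<Omega>(2)])
    then obtain D where gD: "(g has_derivative D) (at ?w)"
      using g2 unfolding C2_on_def by blast
    \<comment> \<open>The two functions agree only on the open set \<open>?A\<close>. Since
      \<open>frechet_derivative\<close> is a choice, the derivative predicates are shown equivalent,
      which makes the choices equal.\<close>
    have "((\<lambda>q. g (Pi_proj q)) has_derivative D') (at p) \<longleftrightarrow> ((\<lambda>q. Pi_proj (f q)) has_derivative D') (at p)" for D'
      using fg by (auto intro: has_derivative_transform_within_open[OF _ openA p])
    then have fd: "frechet_derivative (\<lambda>q. g (Pi_proj q)) (at p) = frechet_derivative (\<lambda>q. Pi_proj (f q)) (at p)"
      by (simp add: frechet_derivative_def)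
    have "Z_op (\<lambda>q. Pi_proj (f q)) p = 2 * \<i> * cnj (fst p) * d_w g ?w"
      using Z_op_comp_Pi(1)[OF gD] by (simp add: Z_op_def fd)
    moreover have "Zbar_op (\<lambda>q. Pi_proj (f q)) p = cnj (2 * \<i> * cnj (fst p)) * d_wbar g ?w"
      using Z_op_comp_Pi(2)[OF gD] by (simp add: Zbar_op_def fd)
    \<comment> \<open>Contactness removes the omega terms from \<open>Z_op_Pi\<close> and
      \<open>Zbar_op_Pi\<close>.\<close>
    ultimately have
      "2 * \<i> * cnj (fst (f p)) * Z_op (\<lambda>q. fst (f q)) p = 2 * \<i> * cnj (fst p) * d_w g ?w"
      "2 * \<i> * cnj (fst (f p)) * Zbar_op (\<lambda>q. fst (f q)) p = cnj (2 * \<i> * cnj (fst p)) * d_wbar g ?w"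
      using contact p by (simp_all add: Z_op_Pi[OF f[OF p]] Zbar_op_Pi[OF f[OF p]] contact_on_def)
    then have "cmod (fst (f p)) * ?Z p = cmod (fst p) * cmod (d_w g ?w)"
      "cmod (fst (f p)) * ?Zb p = cmod (fst p) * cmod (d_wbar g ?w)"
      by (auto dest!: arg_cong[of _ _ cmod] simp: norm_mult)
    then have eq: "cmod (fst (f p)) * (?Z p - ?Zb p) = cmod (fst p) * (cmod (d_w g ?w) - cmod (d_wbar g ?w))"
      by (simp add: right_diff_distrib)
    have "push_forward \<Omega> g \<rho>\<^sub>0 (Pi_proj (f p)) = \<rho>\<^sub>0 ?w / ennreal (cmod (d_w g ?w) - cmod (d_wbar g ?w))"
      by (simp add: push_forward_def fg[OF p] the_inv_into_f_f[OF g_inj w])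
    moreover have "cmod (fst (f p)) > 0"
      using fst_lifted_domain[OF \<Omega>'(2), of "f p"] fA p by auto
    ultimately show ?thesis
      using density_transformation[OF _ le _ _ eq, of "\<rho>\<^sub>0 ?w"]
        heis_jacobian_quasiconformal[OF openA p f f''[OF p] contact]
      by (simp add: Pi_pull_back_def K_heis_def Let_def)
  qed
  have "AE p in lebesgue. p \<in> ?A \<longrightarrow> ?Zb p \<le> ?Z p"
  proof -
    have "AE p in lebesgue_on ?A. ?Zb p \<le> ?Z p"
      using orientation_preserving_heis_AE[OF orient openA]
      by eventually_elim (auto simp: norm_mult intro: mult_left_le_one_le[OF norm_ge_zero norm_ge_zero less_imp_le])
    then show ?thesis
      using openA by (subst (asm) AE_restrict_space_iff) auto
  qed
  then have ae: "AE p in lborel. p \<in> ?A \<longrightarrow> ?Zb p \<le> ?Z p"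
    by (simp add: AE_completion_iff)
  have "modulus_heis ?B (image_family f (lifted_family \<Gamma>)) = modulus_heis ?B (lifted_family (image_family g \<Gamma>))"
    using g_img by (intro modulus_heis_image_lifted_family[OF \<Omega>(2) \<Omega>'(2) fA g_inj _ fg assms(12) f f'_cont contact]) auto
  also have "\<dots> = (\<integral>\<^sup>+p\<in>?B. ?F p \<partial>lborel)"
    by (rule assms(16))
  also have "\<dots> = (\<integral>\<^sup>+p\<in>?A. ?F (f p) * ennreal \<bar>heis_jacobian (f' p)\<bar> \<partial>lborel)"
    by (rule nn_integral_heis_change_of_variables[OF openA openB h f J F])
  also have "\<dots> = (\<integral>\<^sup>+p\<in>?A. ((Pi_pull_back \<rho>\<^sub>0 p)^4 * (ennreal (K_heis f p))^2) \<partial>lborel)"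
    using ae by (intro nn_integral_cong_AE) (auto elim!: eventually_mono simp: indicator_def pointwise)
  finally show ?thesis .
qed

end
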